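(* Assume $\Omega\subset\mathbb{R}^d$ is an open bounded set with Lipschitz boundary and $1<p<\infty$. Then there exist $s_0=s_0(d,p,\Omega)\in(\frac1p,1)$ and $B=B(d,p,\Omega)>1$ such that for all $s_0\le s<1$ and all $u\in W^{s,p}_0(\Omega)$, $$\int_\Omega|u(x)|^p\,dx\le B\,s(1-s)\iint_{\Omega\times\Omega}\frac{|u(x)-u(y)|^p}{|x-y|^{d+sp}}\,dy\,dx.$$ In particular, letting $s\to1^-$, there is a constant $C=C(d,p,\Omega)>0$ such that $\|u\|^p_{L^p(\Omega)}\le C\|\nabla u\|^p_{L^p(\Omega)}$ for all $u\in W^{1,p}_0(\Omega)$.
   Context: For $0<s\le1$, $W^{s,p}(\Omega)$ is the usual (fractional if $s<1$) Sobolev space and $W^{s,p}_0(\Omega)$ is the closure of $C_c^\infty(\Omega)$ in $W^{s,p}(\Omega)$ (for $sp>1$ this is the kernel of the trace operator). *)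

theory Defs
  imports "HOL-Analysis.Analysis"
begin

text \<open>
  Near every boundary point the set is the strict supergraph of a Lipschitz function, in the
  direction of some unit vector \<open>e\<close>; the function lives on the hyperplane orthogonal to \<open>e\<close>
  (a copy of the Euclidean space of dimension \<open>d - 1\<close>), and \<open>x - (x \<bullet> e) *\<^sub>R e\<close> is the
  projection of \<open>x\<close> onto it.
\<close>

definition lipschitz_boundary :: "'a::euclidean_space set \<Rightarrow> bool" where
  "lipschitz_boundary \<Omega> \<longleftrightarrow>
     (\<forall>x0\<in>frontier \<Omega>. \<exists>e g L r. norm e = 1 \<and> r > 0 \<and>
        L-lipschitz_on {z. z \<bullet> e = 0} (g :: 'a \<Rightarrow> real) \<and>
        \<Omega> \<inter> ball x0 r = {x \<in> ball x0 r. x \<bullet> e > g (x - (x \<bullet> e) *\<^sub>R e)})"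

fun Ck :: "nat \<Rightarrow> ('a::euclidean_space \<Rightarrow> real) \<Rightarrow> bool" where
  "Ck 0 f \<longleftrightarrow> continuous_on UNIV f"
| "Ck (Suc k) f \<longleftrightarrow> (\<forall>x. f differentiable at x) \<and>
     (\<forall>b\<in>Basis. Ck k (\<lambda>x. frechet_derivative f (at x) b))"

text \<open>
  The space of smooth functions with compact support in \<open>\<Omega>\<close>, extended by zero to the whole space.
  All other functions below are also total, but only their values on \<open>\<Omega>\<close> matter.
\<close>

definition test_functions :: "'a::euclidean_space set \<Rightarrow> ('a \<Rightarrow> real) set" where
  "test_functions \<Omega> = {\<phi>. (\<forall>k. Ck k \<phi>) \<and>
     compact (closure {x. \<phi> x \<noteq> 0}) \<and> closure {x. \<phi> x \<noteq> 0} \<subseteq> \<Omega>}"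

definition has_weak_gradient ::
  "'a::euclidean_space set \<Rightarrow> ('a \<Rightarrow> real) \<Rightarrow> ('a \<Rightarrow> 'a) \<Rightarrow> bool" where
  "has_weak_gradient \<Omega> u G \<longleftrightarrow>
     (\<forall>K. compact K \<and> K \<subseteq> \<Omega> \<longrightarrow>
        integrable (lebesgue_on K) u \<and> integrable (lebesgue_on K) G) \<and>
     (\<forall>\<phi>\<in>test_functions \<Omega>. \<forall>b\<in>Basis.
        (\<integral>x. u x * frechet_derivative \<phi> (at x) b \<partial>lebesgue_on \<Omega>) =
        - (\<integral>x. (G x \<bullet> b) * \<phi> x \<partial>lebesgue_on \<Omega>))"

text \<open>For open \<open>\<Omega>\<close> a weak gradient is unique up to null sets in \<open>\<Omega>\<close>, if it exists.\<close>

definition weak_gradient ::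
  "'a::euclidean_space set \<Rightarrow> ('a \<Rightarrow> real) \<Rightarrow> ('a \<Rightarrow> 'a)" where
  "weak_gradient \<Omega> u = (SOME G. has_weak_gradient \<Omega> u G)"

definition Lp_energy ::
  "real \<Rightarrow> 'a::euclidean_space set \<Rightarrow> ('a \<Rightarrow> 'b::real_normed_vector) \<Rightarrow> ennreal" where
  "Lp_energy p \<Omega> u = (\<integral>\<^sup>+ x. ennreal (norm (u x) powr p) \<partial>lebesgue_on \<Omega>)"

definition gagliardo_energy ::
  "real \<Rightarrow> real \<Rightarrow> 'a::euclidean_space set \<Rightarrow> ('a \<Rightarrow> real) \<Rightarrow> ennreal" where
  "gagliardo_energy s p \<Omega> u =
     (\<integral>\<^sup>+ x. (\<integral>\<^sup>+ y. ennreal (\<bar>u x - u y\<bar> powr p / norm (x - y) powr (real DIM('a) + s * p))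
        \<partial>lebesgue_on \<Omega>) \<partial>lebesgue_on \<Omega>)"

definition sobolev ::
  "real \<Rightarrow> real \<Rightarrow> 'a::euclidean_space set \<Rightarrow> ('a \<Rightarrow> real) set" where
  "sobolev s p \<Omega> = {u \<in> borel_measurable (lebesgue_on \<Omega>). Lp_energy p \<Omega> u < \<infinity> \<and>
     (if s < 1 then gagliardo_energy s p \<Omega> u < \<infinity>
      else \<exists>G. has_weak_gradient \<Omega> u G \<and> Lp_energy p \<Omega> G < \<infinity>)}"

text \<open>The \<open>p\<close>-th power of the Sobolev norm, for \<open>0 < s \<le> 1\<close>.\<close>

definition sobolev_norm_pow ::
  "real \<Rightarrow> real \<Rightarrow> 'a::euclidean_space set \<Rightarrow> ('a \<Rightarrow> real) \<Rightarrow> ennreal" where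
  "sobolev_norm_pow s p \<Omega> u = Lp_energy p \<Omega> u +
     (if s < 1 then gagliardo_energy s p \<Omega> u else Lp_energy p \<Omega> (weak_gradient \<Omega> u))"

text \<open>
  The closure of the test functions in the Sobolev space; the inequality says that the Sobolev norm
  of \<open>u - \<phi>\<close> is less than \<open>\<epsilon>\<close>.
\<close>

definition sobolev0 ::
  "real \<Rightarrow> real \<Rightarrow> 'a::euclidean_space set \<Rightarrow> ('a \<Rightarrow> real) set" where
  "sobolev0 s p \<Omega> = {u \<in> sobolev s p \<Omega>. \<forall>\<epsilon>>0. \<exists>\<phi>\<in>test_functions \<Omega>.
     sobolev_norm_pow s p \<Omega> (\<lambda>x. u x - \<phi> x) < ennreal (\<epsilon> powr p)}"

end

theory Submission
  imports Defs
begin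

text \<open>
  Both inequalities are first proved for test functions and then carried to the closure of the test
  functions, where the crude inequality \<open>|a + b|^p \<le> 2^p (|a|^p + |b|^p)\<close> is good enough: the
  error can be made arbitrarily small, and only the constant suffers.

  The fractional inequality for a test function is a one-dimensional fact, integrated over all lines.
  Follow a ray from \<open>x \<in> \<Omega>\<close> in direction \<open>v\<close> until it leaves \<open>\<Omega>\<close> at time \<open>\<tau>\<close>. The function vanishes
  at the exit point, so \<open>|u x|\<close> is the difference of the values at the two ends of a segment inside
  \<open>\<Omega>\<close>, of length at most the diameter. Since \<open>s p > 1\<close>, such a difference is controlled by the
  Gagliardo energy of the restriction to the segment, a fractional Morrey inequality
  (\<open>fractional_morrey_line\<close>). Integrating over \<open>x\<close> turns the energy along segments into an energy of
  increments \<open>u (x + h) - u x\<close> with \<open>h\<close> parallel to \<open>v\<close>, and integrating over \<open>v\<close> in a shell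
  reassembles the full energy, by polar coordinates in disguise (\<open>nn_integral_shell_rays_le\<close>).

  The point that needs care is the factor \<open>1 - s\<close>. On an interval \<open>[a, b]\<close> of length \<open>l\<close> compare the
  means of \<open>f\<close> over the windows \<open>[a, a + t]\<close> and \<open>[b - t, b]\<close>: their difference is \<open>1/t\<close>
  times the integral of the increments \<open>f (x + t) - f x\<close>, so the increments at \<^emph>\<open>every\<close> small scale
  \<open>t\<close> carry an energy of at least a constant times \<open>t^p\<close>. Against the weight \<open>t^(-1 - s p)\<close> this
  integrates to \<open>(\<delta> l)^(p (1 - s)) / (p (1 - s))\<close>, which is where \<open>1 / (1 - s)\<close> comes from. Replacing window
  means by point values costs a fraction of the Hoelder constant of exponent \<open>s - 1/p\<close>, and this is
  absorbed: if \<open>H\<close> is a Hoelder constant, then so is \<open>X + H / 2\<close>, where \<open>X\<close> involves only the energy,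
  and iteration brings the constant down to \<open>2 X\<close>. The iteration can start because a test function is
  Lipschitz. All constants are uniform as long as \<open>s\<close> stays above some \<open>s0 > 1/p\<close>.

  For the second inequality let \<open>V\<close> be any weak gradient of a test function \<open>\<phi>\<close>. Formally one
  tests \<open>V\<close> in a coordinate direction \<open>b\<close> with \<open>(x \<bullet> b) \<phi> |\<phi>|^(p - 2)\<close> and integrates by parts, which
  gives \<open>(1/p) \<integral> |\<phi>|^p = - \<integral> (V \<bullet> b) (x \<bullet> b) \<phi> |\<phi>|^(p - 2)\<close>; on a bounded set Young's inequality
  finishes the proof. Replacing \<open>|\<phi>|^(p - 2)\<close> by \<open>(\<phi>^2 + \<delta>^2)^((p - 2) / 2)\<close> makes the test function
  smooth. Since \<open>V\<close> is arbitrary, it may be the difference of the chosen weak gradients of \<open>u\<close> and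
  of \<open>u - \<phi>\<close>, so the passage to the closure never compares two weak gradients of the same function.
\<close>

section \<open>A fractional Morrey inequality on the line\<close>

text \<open>
  Removing one window from \<open>[a, b]\<close> leaves \<open>[a + t, b]\<close>, removing the other leaves \<open>[a, b - t]\<close>, and
  these two intervals are translates of each other by \<open>t\<close>.
\<close>

lemma window_difference_eq_integral_increment:
  fixes f :: "real \<Rightarrow> real"
  assumes cont: "continuous_on UNIV f" and t: "0 \<le> t" "t \<le> b - a"
  shows "integral {b - t..b} f - integral {a..a + t} f
           = integral {a..b - t} (\<lambda>x. f (x + t) - f x)"
proof -
  have int: "f integrable_on {c..d}" for c d
    using cont by (intro integrable_continuous_real) (auto intro: continuous_on_subset)
  have shifted: "continuous_on UNIV (\<lambda>x. f (x + t))"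
    using cont by (intro continuous_on_compose2[OF cont]) (auto intro!: continuous_intros)
  then have int': "(\<lambda>x. f (x + t)) integrable_on {c..d}" for c d
    by (intro integrable_continuous_real) (auto intro: continuous_on_subset)
  have "integral {a..b - t} (\<lambda>x. f (x + t) - f x)
      = integral {a..b - t} (\<lambda>x. f (x + t)) - integral {a..b - t} f"
    by (intro integral_diff int int')
  also have "integral {a..b - t} (\<lambda>x. f (x + t)) = integral {a + t..b} f"
    using integral_shift_real_ivl[of "a + t" t b f] by simp
  finally show ?thesis
    using Henstock_Kurzweil_Integration.integral_combine[of a "a + t" b f, OF _ _ int]
      Henstock_Kurzweil_Integration.integral_combine[of a "b - t" b f, OF _ _ int] t
    by (simp add: algebra_simps)
qed

text \<open>
  This is Jensen's inequality up to the factor \<open>2^p\<close>. The pointwise bound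
  \<open>m^(p - 1) (|g| - m) \<le> |g|^p\<close> replaces convexity; \<open>m = Y / (2 l)\<close> is half the lower bound \<open>Y / l\<close> for
  the mean of \<open>|g|\<close>, so that subtracting \<open>m\<close> costs at most half of the integral.
\<close>

lemma power_integral_lower_bound:
  fixes g :: "real \<Rightarrow> real"
  assumes cont: "continuous_on {a..c} g" and "a \<le> c" "c - a \<le> l" "0 < l" "0 < Y" "1 < p"
    and Y: "Y \<le> \<bar>integral {a..c} g\<bar>"
  shows "ennreal ((Y / 2) powr p * l powr (1 - p))
           \<le> (\<integral>\<^sup>+x. ennreal (\<bar>g x\<bar> powr p) * indicator {a<..<c} x \<partial>lborel)"
proof -
  define m where "m = Y / (2 * l)"
  have m: "m > 0" using assms by (simp add: m_def)
  have absg: "(\<lambda>x. \<bar>g x\<bar>) integrable_on {a..c}"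
    using cont by (intro integrable_continuous_real continuous_intros)
  have pow: "continuous_on {a..c} (\<lambda>x. \<bar>g x\<bar> powr p)"
    using cont \<open>1 < p\<close> by (intro continuous_on_powr' continuous_intros) auto
  have pointwise: "m powr (p - 1) * (\<bar>g x\<bar> - m) \<le> \<bar>g x\<bar> powr p" for x
  proof (cases "\<bar>g x\<bar> \<le> m")
    case True
    then have "m powr (p - 1) * (\<bar>g x\<bar> - m) \<le> 0" by (intro mult_nonneg_nonpos) auto
    then show ?thesis by (smt (verit) powr_ge_zero)
  next
    case False
    then have "m powr (p - 1) * (\<bar>g x\<bar> - m) \<le> \<bar>g x\<bar> powr (p - 1) * \<bar>g x\<bar>"
      using m \<open>1 < p\<close> by (intro mult_mono powr_mono2) auto
    also have "\<dots> = \<bar>g x\<bar> powr p"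
      using False m by (simp add: powr_diff)
    finally show ?thesis .
  qed
  have "Y \<le> integral {a..c} (\<lambda>x. \<bar>g x\<bar>)"
    using Y Henstock_Kurzweil_Integration.integral_norm_bound_integral[of g "{a..c}" "\<lambda>x. \<bar>g x\<bar>"]
      absg integrable_continuous_real[OF cont] by simp
  moreover have "integral {a..c} (\<lambda>x. m powr (p - 1) * (\<bar>g x\<bar> - m))
      = m powr (p - 1) * (integral {a..c} (\<lambda>x. \<bar>g x\<bar>) - m * (c - a))"
    using \<open>a \<le> c\<close> by (simp add: integral_diff[OF absg integrable_const_ivl] mult.commute)
  moreover have "m * (c - a) \<le> Y / 2"
  proof -
    have "m * (c - a) \<le> m * l" using assms m by (intro mult_left_mono) auto
    also have "\<dots> = Y / 2" using \<open>0 < l\<close> by (simp add: m_def)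
    finally show ?thesis .
  qed
  ultimately have "m powr (p - 1) * (Y / 2) \<le> integral {a..c} (\<lambda>x. m powr (p - 1) * (\<bar>g x\<bar> - m))"
    by (simp only:) (intro mult_left_mono; simp)
  also have "\<dots> \<le> integral {a..c} (\<lambda>x. \<bar>g x\<bar> powr p)"
    using integrable_continuous_real[OF pow] pointwise cont
    by (intro integral_le) (auto intro!: integrable_continuous_real continuous_intros)
  finally have le: "m powr (p - 1) * (Y / 2) \<le> integral {a..c} (\<lambda>x. \<bar>g x\<bar> powr p)" .
  have "m powr (p - 1) * (Y / 2) = (Y / 2) powr p * l powr (1 - p)"
  proof -
    have "m powr (p - 1) = (Y / 2) powr (p - 1) * l powr (1 - p)"
      using assms by (simp add: m_def powr_divide powr_mult powr_diff field_simps)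
    moreover have "(Y / 2) powr (p - 1) * (Y / 2) = (Y / 2) powr p"
      using \<open>0 < Y\<close> by (simp add: powr_diff)
    ultimately show ?thesis by (simp add: mult_ac)
  qed
  moreover have "(\<integral>\<^sup>+x. ennreal (\<bar>g x\<bar> powr p) * indicator {a<..<c} x \<partial>lborel)
      = (\<integral>\<^sup>+x. ennreal (\<bar>g x\<bar> powr p) * indicator {a..c} x \<partial>lborel)"
  proof (rule nn_integral_cong_AE)
    show "AE x in lborel. ennreal (\<bar>g x\<bar> powr p) * indicator {a<..<c} x
        = ennreal (\<bar>g x\<bar> powr p) * indicator {a..c} x"
      using AE_lborel_singleton[of a] AE_lborel_singleton[of c]
      by eventually_elim (auto simp: indicator_def)
  qed
  moreover have "\<dots> = ennreal (integral {a..c} (\<lambda>x. \<bar>g x\<bar> powr p))"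
    using pow by (intro nn_integral_has_integral_lebesgue' integrable_integral integrable_continuous_real) auto
  ultimately show ?thesis using le by (simp add: ennreal_leI)
qed


lemma window_average_close:
  fixes f :: "real \<Rightarrow> real"
  assumes cont: "continuous_on UNIV f" and "0 \<le> t" and e: "\<And>x. x \<in> {u..u + t} \<Longrightarrow> \<bar>f x - c\<bar> \<le> e"
  shows "\<bar>integral {u..u + t} f - t * c\<bar> \<le> t * e"
proof -
  have int: "f integrable_on {u..u + t}"
    using cont by (intro integrable_continuous_real) (auto intro: continuous_on_subset)
  have "integral {u..u + t} f \<le> integral {u..u + t} (\<lambda>x. c + e)"
    using e(1) by (intro integral_le int integrable_const_ivl) (smt (verit))
  moreover have "integral {u..u + t} (\<lambda>x. c - e) \<le> integral {u..u + t} f"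
    using e(1) by (intro integral_le int integrable_const_ivl) (smt (verit))
  ultimately show ?thesis using \<open>0 \<le> t\<close> by (simp add: algebra_simps abs_le_iff)
qed

text \<open>
  Half the Gagliardo energy of \<open>f\<close> on the interval, with the distance \<open>t\<close> of the two points as the
  outer variable.
\<close>

definition line_energy :: "real \<Rightarrow> real \<Rightarrow> (real \<Rightarrow> real) \<Rightarrow> real \<Rightarrow> real \<Rightarrow> ennreal" where
  "line_energy s p f a b = (\<integral>\<^sup>+t. ennreal (t powr (- 1 - s * p)) *
     (\<integral>\<^sup>+x. ennreal (\<bar>f (x + t) - f x\<bar> powr p) * indicator {a<..<b - t} x \<partial>lborel) *
     indicator {0<..<b - a} t \<partial>lborel)"

lemma line_energy_mono:
  assumes "a \<le> a'" "b' \<le> b"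
  shows "line_energy s p f a' b' \<le> line_energy s p f a b"
  unfolding line_energy_def using assms
  by (intro nn_integral_mono mult_mono) (auto simp: indicator_def)

text \<open>
  Each scale \<open>t \<le> \<delta> l\<close> contributes: the window means at the two ends differ by at least \<open>Z\<close>, because
  the Hoelder bound lets each mean miss the value at its end point by at most \<open>H (\<delta> l)^\<alpha>\<close>. The
  resulting lower bound \<open>t^(p (1 - s) - 1)\<close> has an integral that blows up like \<open>1 / (1 - s)\<close>.
\<close>

lemma line_energy_lower_bound:
  fixes f :: "real \<Rightarrow> real"
  assumes cont: "continuous_on UNIV f" and "1 < p" "s < 1" "0 < \<alpha>" "a < b" and \<delta>: "0 < \<delta>" "\<delta> < 1"
    and H: "\<And>x y. x \<in> {a..b} \<Longrightarrow> y \<in> {a..b} \<Longrightarrow> \<bar>f x - f y\<bar> \<le> H * \<bar>x - y\<bar> powr \<alpha>" "0 \<le> H"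
    and Z_def: "Z = \<bar>f b - f a\<bar> - 2 * H * (\<delta> * (b - a)) powr \<alpha>" and "0 < Z"
  shows "ennreal ((Z / 2) powr p * (b - a) powr (1 - p) *
           ((\<delta> * (b - a)) powr (p * (1 - s)) / (p * (1 - s)))) \<le> line_energy s p f a b"
proof -
  let ?l = "b - a"
  let ?c = "(Z / 2) powr p * ?l powr (1 - p)"
  have inner: "ennreal ((Z * t / 2) powr p * ?l powr (1 - p))
      \<le> (\<integral>\<^sup>+x. ennreal (\<bar>f (x + t) - f x\<bar> powr p) * indicator {a<..<b - t} x \<partial>lborel)"
    if t: "0 < t" "t \<le> \<delta> * ?l" for t
  proof -
    define e where "e = H * (\<delta> * ?l) powr \<alpha>"
    have "\<delta> * ?l < ?l" using \<delta> \<open>a < b\<close> by simp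
    with t have tl: "t < ?l" by simp
    have "\<bar>f x - f y\<bar> \<le> e" if "x \<in> {a..b}" "y \<in> {a..b}" "\<bar>x - y\<bar> \<le> t" for x y
    proof -
      have "\<bar>f x - f y\<bar> \<le> H * \<bar>x - y\<bar> powr \<alpha>" using H that by simp
      also have "\<dots> \<le> e" unfolding e_def using that t H(2) \<open>0 < \<alpha>\<close>
        by (intro mult_left_mono powr_mono2) auto
      finally show ?thesis .
    qed
    then have "\<bar>integral {a..a + t} f - t * f a\<bar> \<le> t * e"
        "\<bar>integral {b - t..b - t + t} f - t * f b\<bar> \<le> t * e"
      using t tl by (intro window_average_close[OF cont]; simp)+
    then have "t * \<bar>f b - f a\<bar> - 2 * (t * e) \<le> \<bar>integral {b - t..b} f - integral {a..a + t} f\<bar>"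
      using t by (simp add: abs_mult[of t, symmetric, simplified abs_of_pos] right_diff_distrib abs_if split: if_splits)
    then have "Z * t \<le> \<bar>integral {a..b - t} (\<lambda>x. f (x + t) - f x)\<bar>"
      using window_difference_eq_integral_increment[OF cont, of t b a] t tl
      by (simp add: Z_def e_def algebra_simps)
    moreover have "continuous_on {a..b - t} (\<lambda>x. f (x + t) - f x)"
      by (intro continuous_intros continuous_on_compose2[OF cont]) auto
    ultimately show ?thesis
      using t tl \<open>0 < Z\<close> \<open>1 < p\<close> by (intro power_integral_lower_bound) auto
  qed
  have powers: "((\<lambda>t. ?c * t powr (p * (1 - s) - 1)) has_integral
      ?c * ((\<delta> * ?l) powr (p * (1 - s)) / (p * (1 - s)))) {0..\<delta> * ?l}"
    using has_integral_powr_from_0[of "p * (1 - s) - 1" "\<delta> * ?l"] \<open>1 < p\<close> \<open>s < 1\<close> \<delta> \<open>a < b\<close>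
    by (intro has_integral_mult_right) simp
  have "ennreal (?c * ((\<delta> * ?l) powr (p * (1 - s)) / (p * (1 - s))))
      = (\<integral>\<^sup>+t. ennreal (?c * t powr (p * (1 - s) - 1)) * indicator {0..\<delta> * ?l} t \<partial>lborel)"
    by (intro nn_integral_has_integral_lebesgue'[symmetric] powers) simp
  also have "\<dots> \<le> line_energy s p f a b"
    unfolding line_energy_def
  proof (intro nn_integral_mono)
    fix t :: real
    let ?I = "\<integral>\<^sup>+x. ennreal (\<bar>f (x + t) - f x\<bar> powr p) * indicator {a<..<b - t} x \<partial>lborel"
    show "ennreal (?c * t powr (p * (1 - s) - 1)) * indicator {0..\<delta> * ?l} t
        \<le> ennreal (t powr (- 1 - s * p)) * ?I * indicator {0<..<b - a} t"
    proof (cases "0 < t \<and> t \<le> \<delta> * ?l")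
      case True
      then have t: "0 < t" "t \<le> \<delta> * ?l" by auto
      have "\<delta> * ?l < ?l" using \<delta> \<open>a < b\<close> by simp
      then have tl: "t < ?l" using t by simp
      have "?c * t powr (p * (1 - s) - 1)
          = t powr (- 1 - s * p) * ((Z * t / 2) powr p * ?l powr (1 - p))"
      proof -
        have "t powr (p * (1 - s) - 1) = t powr (- 1 - s * p) * t powr p"
          by (simp add: powr_add[symmetric] algebra_simps)
        moreover have "(Z * t / 2) powr p = (Z / 2) powr p * t powr p"
          using powr_mult[of "Z / 2" t p] t \<open>0 < Z\<close> by (simp add: mult.commute)
        ultimately show ?thesis by simp
      qed
      then have "ennreal (?c * t powr (p * (1 - s) - 1))
          = ennreal (t powr (- 1 - s * p)) * ennreal ((Z * t / 2) powr p * ?l powr (1 - p))"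
        by (simp only:) (simp add: ennreal_mult)
      also have "\<dots> \<le> ennreal (t powr (- 1 - s * p)) * ?I"
        by (intro mult_left_mono inner t) simp
      finally show ?thesis using t tl by simp
    qed (auto simp: indicator_def)
  qed
  finally show ?thesis .
qed

text \<open>
  The exponent \<open>s - 1/p\<close> is the one for which the lower bound on the energy scales like the power
  \<open>p\<close> of a Hoelder quotient, so that the length of the interval drops out. The smallness of \<open>\<delta>\<close> is
  what brings the old constant \<open>H\<close> in with a factor below one.
\<close>

lemma holder_constant_improvement:
  fixes f :: "real \<Rightarrow> real"
  assumes cont: "continuous_on UNIV f" and "1 < p" "1 / p < s" "s < 1" and \<delta>: "0 < \<delta>" "\<delta> < 1"
    and small: "4 * \<delta> powr (s - 1 / p) \<le> 1"
    and H: "\<And>x y. x \<in> {a..b} \<Longrightarrow> y \<in> {a..b} \<Longrightarrow> \<bar>f x - f y\<bar> \<le> H * \<bar>x - y\<bar> powr (s - 1 / p)" "0 \<le> H"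
    and w: "line_energy s p f a b \<le> ennreal w" "0 \<le> w"
    and xy: "x \<in> {a..b}" "y \<in> {a..b}"
  shows "\<bar>f x - f y\<bar> \<le> (2 * (w * p * (1 - s) * \<delta> powr (- p)) powr (1 / p) + H / 2)
            * \<bar>x - y\<bar> powr (s - 1 / p)"
  using xy
proof (induction x y rule: linorder_wlog)
  case (sym x y)
  then show ?case by (simp add: abs_minus_commute)
next
  case (le x y)
  define \<alpha> l where "\<alpha> = s - 1 / p" and "l = y - x"
  define X where "X = w * p * (1 - s) * \<delta> powr (- p)"
  have "0 < \<alpha>" using assms by (simp add: \<alpha>_def)
  have "0 \<le> X" using assms by (simp add: X_def)
  have "0 < s" using \<open>1 < p\<close> \<open>1 / p < s\<close> by (smt (verit) divide_pos_pos)
  show ?case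
  proof (cases "x = y")
    case False
    with le have "x < y" by simp
    then have "0 < l" by (simp add: l_def)
    define Z where "Z = \<bar>f y - f x\<bar> - 2 * H * (\<delta> * (y - x)) powr \<alpha>"
    have "Z / 2 \<le> X powr (1 / p) * l powr \<alpha>"
    proof (cases "0 < Z")
      case True
      let ?q = "p * (1 - s)"
      have q: "0 < ?q" using assms by simp
      have "ennreal ((Z / 2) powr p * l powr (1 - p) * ((\<delta> * l) powr ?q / ?q))
          \<le> line_energy s p f x y"
        unfolding l_def
        using le H True \<open>x < y\<close> \<open>0 < \<alpha>\<close> assms
        by (intro line_energy_lower_bound[where \<alpha> = \<alpha> and H = H]) (auto simp: Z_def \<alpha>_def)
      also have "\<dots> \<le> line_energy s p f a b" using le by (intro line_energy_mono) auto
      also have "\<dots> \<le> ennreal w" by (rule w)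
      finally have "(Z / 2) powr p * l powr (1 - p) * ((\<delta> * l) powr ?q / ?q) \<le> w"
        using w(2) by simp
      then have "(Z / 2) powr p * (l powr (1 - p) * l powr ?q) * \<delta> powr ?q \<le> w * ?q"
        using q \<delta> \<open>0 < l\<close> by (simp add: powr_mult field_simps)
      moreover have "l powr (1 - p) * l powr ?q = l powr (- (\<alpha> * p))"
        using \<open>1 < p\<close> by (simp add: powr_add[symmetric] \<alpha>_def algebra_simps)
      moreover have "\<delta> powr p \<le> \<delta> powr ?q"
        using \<delta> \<open>1 < p\<close> \<open>0 < s\<close> by (intro powr_mono') (auto simp: algebra_simps)
      ultimately have "(Z / 2) powr p * l powr (- (\<alpha> * p)) * \<delta> powr p \<le> w * ?q"
        by (smt (verit, best) mult_left_mono mult_nonneg_nonneg powr_ge_zero)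
      then have "(Z / 2) powr p \<le> X * l powr (\<alpha> * p)"
        using \<delta> \<open>0 < l\<close> by (simp add: X_def powr_minus field_simps)
      also have "\<dots> = (X powr (1 / p) * l powr \<alpha>) powr p"
        using assms \<open>0 \<le> X\<close> by (simp add: powr_mult powr_powr)
      finally show ?thesis
        using True \<open>1 < p\<close> by (smt (verit) powr_less_mono2 powr_ge_zero mult_nonneg_nonneg)
    next
      case False
      then show ?thesis by (smt (verit) powr_ge_zero mult_nonneg_nonneg half_gt_zero_iff)
    qed
    moreover have "2 * H * (\<delta> * (y - x)) powr \<alpha> \<le> H / 2 * l powr \<alpha>"
    proof -
      have "2 * H * (\<delta> * (y - x)) powr \<alpha> = (H / 2) * (4 * \<delta> powr \<alpha>) * l powr \<alpha>"
        using \<delta> \<open>0 < l\<close> by (simp add: powr_mult l_def)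
      also have "\<dots> \<le> H / 2 * 1 * l powr \<alpha>"
        using small H(2) by (intro mult_right_mono mult_left_mono) (auto simp: \<alpha>_def)
      finally show ?thesis by simp
    qed
    ultimately show ?thesis
      using \<open>x < y\<close> by (simp add: Z_def X_def l_def \<alpha>_def abs_minus_commute algebra_simps)
  qed simp
qed

text \<open>
  Iterating the improvement from the Hoelder constant that the Lipschitz bound provides halves the
  excess over \<open>4 X^(1/p)\<close> each time; the Lipschitz constant disappears in the limit.
\<close>

lemma fractional_morrey_line:
  fixes f :: "real \<Rightarrow> real"
  assumes lip: "L-lipschitz_on UNIV f" and "1 < p" "1 / p < s" "s < 1" and \<delta>: "0 < \<delta>" "\<delta> < 1"
    and small: "4 * \<delta> powr (s - 1 / p) \<le> 1" and "a < b"
  shows "ennreal (\<bar>f b - f a\<bar> powr p)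
    \<le> ennreal (4 powr p * \<delta> powr (- p) * p * (1 - s) * (b - a) powr (s * p - 1)) * line_energy s p f a b"
proof (cases "line_energy s p f a b" rule: ennreal_cases)
  case (real w)
  define \<alpha> X where "\<alpha> = s - 1 / p" and "X = w * p * (1 - s) * \<delta> powr (- p)"
  have "0 \<le> X" using assms real by (simp add: X_def)
  have \<alpha>: "0 < \<alpha>" "\<alpha> < 1" using assms by (simp_all add: \<alpha>_def) (smt (verit) divide_pos_pos)
  have cont: "continuous_on UNIV f" using lip by (rule lipschitz_on_continuous_on)
  have "0 \<le> L" using lip by (rule lipschitz_on_nonneg)
  define H0 where "H0 = L * (b - a) powr (1 - \<alpha>)"
  have "0 \<le> H0" using \<open>0 \<le> L\<close> by (simp add: H0_def)
  have holder: "\<bar>f x - f y\<bar> \<le> (4 * X powr (1 / p) + H0 / 2 ^ n) * \<bar>x - y\<bar> powr \<alpha>"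
    if "x \<in> {a..b}" "y \<in> {a..b}" for x y n
    using that
  proof (induction n arbitrary: x y)
    case 0
    have "\<bar>f x - f y\<bar> \<le> L * \<bar>x - y\<bar>"
      using lipschitz_onD[OF lip, of x y] by (simp add: dist_real_def)
    also have "\<dots> = L * (\<bar>x - y\<bar> powr (1 - \<alpha>) * \<bar>x - y\<bar> powr \<alpha>)"
      by (simp add: powr_add[symmetric])
    also have "\<dots> \<le> L * ((b - a) powr (1 - \<alpha>) * \<bar>x - y\<bar> powr \<alpha>)"
      using \<open>0 \<le> L\<close> \<alpha> 0 by (intro mult_left_mono mult_right_mono powr_mono2) auto
    also have "\<dots> \<le> (4 * X powr (1 / p) + H0) * \<bar>x - y\<bar> powr \<alpha>"
      by (simp add: H0_def algebra_simps)
    finally show ?case by simp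
  next
    case (Suc n)
    have "\<bar>f x - f y\<bar> \<le> (2 * (w * p * (1 - s) * \<delta> powr (- p)) powr (1 / p) +
        (4 * X powr (1 / p) + H0 / 2 ^ n) / 2) * \<bar>x - y\<bar> powr (s - 1 / p)"
      using Suc \<open>0 \<le> H0\<close> assms real cont
      by (intro holder_constant_improvement[of f p s \<delta> a b]) (auto simp: \<alpha>_def intro!: add_nonneg_nonneg)
    then show ?case by (simp add: X_def \<alpha>_def field_simps)
  qed
  have "(\<lambda>n. (4 * X powr (1 / p) + H0 * inverse (2 ^ n)) * \<bar>b - a\<bar> powr \<alpha>)
      \<longlonglongrightarrow> (4 * X powr (1 / p) + H0 * 0) * \<bar>b - a\<bar> powr \<alpha>"
    by (intro tendsto_intros LIMSEQ_inverse_realpow_zero) simp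
  moreover have "\<bar>f b - f a\<bar> \<le> (4 * X powr (1 / p) + H0 * inverse (2 ^ n)) * \<bar>b - a\<bar> powr \<alpha>" for n
    using holder[of b a n] \<open>a < b\<close> by (simp add: divide_inverse)
  ultimately have "\<bar>f b - f a\<bar> \<le> (4 * X powr (1 / p) + H0 * 0) * \<bar>b - a\<bar> powr \<alpha>"
    by (intro LIMSEQ_le_const) auto
  then have "\<bar>f b - f a\<bar> powr p \<le> (4 * X powr (1 / p) * \<bar>b - a\<bar> powr \<alpha>) powr p"
    using \<open>1 < p\<close> by (intro powr_mono2) simp_all
  also have "\<dots> = 4 powr p * X * (b - a) powr (s * p - 1)"
    using \<open>0 \<le> X\<close> \<open>1 < p\<close> \<open>a < b\<close> by (simp add: powr_mult powr_powr \<alpha>_def left_diff_distrib)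
  also have "\<dots> = 4 powr p * \<delta> powr (- p) * p * (1 - s) * (b - a) powr (s * p - 1) * w"
    by (simp add: X_def)
  finally show ?thesis
    using assms real by (simp add: ennreal_mult[symmetric] ennreal_leI)
next
  case top
  have "4 powr p * \<delta> powr (- p) * p * (1 - s) * (b - a) powr (s * p - 1) \<noteq> 0"
    using assms by simp
  then show ?thesis using top assms by (simp add: ennreal_mult_top)
qed


section \<open>Energies of increments\<close>

lemma exit_time:
  fixes x v :: "'a::euclidean_space"
  assumes "open \<Omega>" "x \<in> \<Omega>" "1 \<le> norm v"
    and D: "\<And>x y. x \<in> \<Omega> \<Longrightarrow> y \<in> \<Omega> \<Longrightarrow> dist x y \<le> D"
  obtains \<tau> where "0 < \<tau>" "\<tau> \<le> D" "x + \<tau> *\<^sub>R v \<notin> \<Omega>"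
    "\<And>r. 0 \<le> r \<Longrightarrow> r < \<tau> \<Longrightarrow> x + r *\<^sub>R v \<in> \<Omega>"
proof -
  \<comment> \<open>The times spent outside \<open>\<Omega>\<close>: a closed set, whose infimum is the exit time.\<close>
  define S where "S = {0..} \<inter> (\<lambda>r. x + r *\<^sub>R v) -` (- \<Omega>)"
  have far: "r \<in> S" if "0 \<le> r" "D < r" for r
  proof (rule ccontr)
    assume "r \<notin> S"
    then have "dist x (x + r *\<^sub>R v) \<le> D" using that assms by (intro D) (auto simp: S_def)
    moreover have "r * 1 \<le> r * norm v" using assms that by (intro mult_left_mono) auto
    ultimately show False using that by (simp add: dist_norm)
  qed
  have "0 \<le> D" using D[OF \<open>x \<in> \<Omega>\<close> \<open>x \<in> \<Omega>\<close>] by simp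
  have "closed S"
    unfolding S_def using \<open>open \<Omega>\<close>
    by (intro closed_Int closed_vimage) (auto intro!: continuous_intros)
  moreover have "S \<noteq> {}" using far[of "D + 1"] \<open>0 \<le> D\<close> by auto
  moreover have bdd: "bdd_below S" by (rule bdd_belowI[of _ 0]) (auto simp: S_def)
  ultimately have Inf: "Inf S \<in> S" by (rule closed_contains_Inf[rotated 2])
  have below: "x + r *\<^sub>R v \<in> \<Omega>" if "0 \<le> r" "r < Inf S" for r
    using cInf_lower[OF _ bdd, of r] that by (force simp: S_def)
  show ?thesis
  proof
    show "0 < Inf S" using Inf \<open>x \<in> \<Omega>\<close> by (cases "Inf S = 0") (auto simp: S_def)
    show "x + Inf S *\<^sub>R v \<notin> \<Omega>" using Inf by (simp add: S_def)
    show "Inf S \<le> D"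
    proof (rule ccontr)
      assume "\<not> Inf S \<le> D"
      then have "(D + Inf S) / 2 \<in> S" using \<open>0 \<le> D\<close> by (intro far) auto
      then have "Inf S \<le> (D + Inf S) / 2" using bdd by (rule cInf_lower)
      with \<open>\<not> Inf S \<le> D\<close> show False by simp
    qed
  qed (rule below)
qed

definition shift_energy :: "real \<Rightarrow> 'a::euclidean_space set \<Rightarrow> ('a \<Rightarrow> real) \<Rightarrow> 'a \<Rightarrow> ennreal" where
  "shift_energy p \<Omega> u h = (\<integral>\<^sup>+x. ennreal (\<bar>u (x + h) - u x\<bar> powr p) *
     indicator \<Omega> x * indicator \<Omega> (x + h) \<partial>lborel)"

lemma borel_measurable_shift_energy:
  fixes u :: "'a::euclidean_space \<Rightarrow> real"
  assumes [measurable]: "u \<in> borel_measurable borel" "\<Omega> \<in> sets borel"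
  shows "shift_energy p \<Omega> u \<in> borel_measurable borel"
proof -
  have "(\<lambda>h. \<integral>\<^sup>+x. ennreal (\<bar>u (x + h) - u x\<bar> powr p) *
     indicator \<Omega> x * indicator \<Omega> (x + h) \<partial>lborel) \<in> borel_measurable (borel :: 'a measure)"
    by measurable
  then show ?thesis by (simp add: shift_energy_def[abs_def])
qed

lemma nn_integral_lborel_translate:
  fixes F :: "'a::euclidean_space \<Rightarrow> ennreal"
  assumes [measurable]: "F \<in> borel_measurable borel"
  shows "(\<integral>\<^sup>+x. F (x + c) \<partial>lborel) = (\<integral>\<^sup>+x. F x \<partial>lborel)"
proof -
  have "(\<integral>\<^sup>+x. F x \<partial>lborel) = (\<integral>\<^sup>+x. F x \<partial>distr lborel borel ((+) c))"
    by (simp add: lborel_distr_plus)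
  also have "\<dots> = (\<integral>\<^sup>+x. F (x + c) \<partial>lborel)"
    by (simp add: nn_integral_distr add.commute)
  finally show ?thesis ..
qed

lemma nn_integral_lborel_scaleR:
  fixes F :: "'a::euclidean_space \<Rightarrow> ennreal"
  assumes [measurable]: "F \<in> borel_measurable borel" and "0 < c"
  shows "(\<integral>\<^sup>+x. F (c *\<^sub>R x) \<partial>lborel) = ennreal (c powr - real DIM('a)) * (\<integral>\<^sup>+x. F x \<partial>lborel)"
proof -
  have "(\<integral>\<^sup>+x. F x \<partial>lborel) = ennreal (c ^ DIM('a)) * (\<integral>\<^sup>+x. F (c *\<^sub>R x) \<partial>lborel)"
    using \<open>0 < c\<close>
    by (subst lborel_affine[of c 0]) (simp_all add: nn_integral_density nn_integral_distr nn_integral_cmult)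
  moreover have "ennreal (c powr - real DIM('a)) * ennreal (c ^ DIM('a)) = 1"
    using \<open>0 < c\<close> by (simp add: ennreal_mult[symmetric] powr_minus powr_realpow)
  ultimately show ?thesis by (simp add: mult.assoc[symmetric])
qed

text \<open>
  The substitution \<open>y = x + h\<close>, followed by an exchange of the order of integration.
\<close>

lemma gagliardo_energy_eq_shift_energy:
  fixes u :: "'a::euclidean_space \<Rightarrow> real"
  assumes [measurable]: "u \<in> borel_measurable borel" "\<Omega> \<in> sets borel"
  shows "gagliardo_energy s p \<Omega> u
    = (\<integral>\<^sup>+h. shift_energy p \<Omega> u h * ennreal (1 / norm h powr (real DIM('a) + s * p)) \<partial>lborel)"
proof -
  let ?q = "real DIM('a) + s * p"
  let ?K = "\<lambda>x y. ennreal (\<bar>u x - u y\<bar> powr p / norm (x - y) powr ?q)"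
  have "gagliardo_energy s p \<Omega> u
      = (\<integral>\<^sup>+x. (\<integral>\<^sup>+y. ?K x y * indicator \<Omega> y \<partial>lborel) * indicator \<Omega> x \<partial>lborel)"
    unfolding gagliardo_energy_def
    by (simp add: nn_integral_restrict_space nn_integral_completion)
  also have "\<dots> = (\<integral>\<^sup>+x. (\<integral>\<^sup>+h. ?K x (h + x) * indicator \<Omega> (h + x) \<partial>lborel) * indicator \<Omega> x \<partial>lborel)"
    by (subst nn_integral_lborel_translate[where F = "\<lambda>y. ?K _ y * indicator \<Omega> y"]) auto
  also have "\<dots> = (\<integral>\<^sup>+x. \<integral>\<^sup>+h. ennreal (\<bar>u (x + h) - u x\<bar> powr p) * indicator \<Omega> x * indicator \<Omega> (x + h)
      * ennreal (1 / norm h powr ?q) \<partial>lborel \<partial>lborel)"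
  proof (intro nn_integral_cong)
    fix x
    show "(\<integral>\<^sup>+h. ?K x (h + x) * indicator \<Omega> (h + x) \<partial>lborel) * indicator \<Omega> x
      = (\<integral>\<^sup>+h. ennreal (\<bar>u (x + h) - u x\<bar> powr p) * indicator \<Omega> x * indicator \<Omega> (x + h)
      * ennreal (1 / norm h powr ?q) \<partial>lborel)"
      by (subst nn_integral_multc[symmetric], measurable, intro nn_integral_cong)
         (simp add: ennreal_mult[symmetric] abs_minus_commute add.commute split: split_indicator)
  qed
  also have "\<dots> = (\<integral>\<^sup>+h. \<integral>\<^sup>+x. ennreal (\<bar>u (x + h) - u x\<bar> powr p) * indicator \<Omega> x * indicator \<Omega> (x + h)
      * ennreal (1 / norm h powr ?q) \<partial>lborel \<partial>lborel)"
    by (rule lborel_pair.Fubini') measurable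
  also have "\<dots> = (\<integral>\<^sup>+h. shift_energy p \<Omega> u h * ennreal (1 / norm h powr ?q) \<partial>lborel)"
    unfolding shift_energy_def by (intro nn_integral_cong nn_integral_multc) measurable
  finally show ?thesis .
qed

text \<open>
  Polar coordinates without a measure on the sphere: directions \<open>v\<close> range over a shell of positive
  volume, and \<open>h = t v\<close> covers a given \<open>h\<close> exactly for the \<open>t\<close> in \<open>(|h|/2, |h|)\<close>, an interval whose
  length is comparable to each of its points.
\<close>

lemma nn_integral_shell_rays_le:
  fixes g :: "'a::euclidean_space \<Rightarrow> ennreal"
  assumes [measurable]: "g \<in> borel_measurable borel" and "0 < q"
  shows "(\<integral>\<^sup>+v. (\<integral>\<^sup>+t. ennreal (t powr (- 1 - q)) * g (t *\<^sub>R v) * indicator {0<..} t \<partial>lborel)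
            * indicator {v. 1 < norm v \<and> norm v < 2} v \<partial>lborel)
    \<le> ennreal (2 powr (real DIM('a) + q)) * (\<integral>\<^sup>+h. g h * ennreal (1 / norm h powr (real DIM('a) + q)) \<partial>lborel)"
proof -
  let ?d = "real DIM('a)"
  let ?S = "{v::'a. 1 < norm v \<and> norm v < 2}"
  have [measurable]: "?S \<in> sets borel" by measurable
  have ind: "indicator ?S v = (indicator {1<..<2} (norm v) :: ennreal)" for v :: 'a
    by (auto simp: indicator_def)
  have "(\<integral>\<^sup>+v. (\<integral>\<^sup>+t. ennreal (t powr (- 1 - q)) * g (t *\<^sub>R v) * indicator {0<..} t \<partial>lborel) * indicator ?S v \<partial>lborel)
      = (\<integral>\<^sup>+v. \<integral>\<^sup>+t. ennreal (t powr (- 1 - q)) * g (t *\<^sub>R v) * indicator {0<..} t * indicator ?S v \<partial>lborel \<partial>lborel)"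
    by (intro nn_integral_cong nn_integral_multc[symmetric]) measurable
  also have "\<dots> = (\<integral>\<^sup>+t. \<integral>\<^sup>+v. ennreal (t powr (- 1 - q)) * g (t *\<^sub>R v) * indicator {0<..} t * indicator ?S v \<partial>lborel \<partial>lborel)"
    unfolding ind by (rule lborel_pair.Fubini'[symmetric]) measurable
  also have "\<dots> = (\<integral>\<^sup>+t. \<integral>\<^sup>+h. ennreal (t powr (- 1 - q - ?d)) * indicator {0<..} t *
      (g h * indicator {1<..<2} (norm h / t)) \<partial>lborel \<partial>lborel)"
  proof (rule nn_integral_cong)
    fix t :: real
    show "(\<integral>\<^sup>+v. ennreal (t powr (- 1 - q)) * g (t *\<^sub>R v) * indicator {0<..} t * indicator ?S v \<partial>lborel)
      = (\<integral>\<^sup>+h. ennreal (t powr (- 1 - q - ?d)) * indicator {0<..} t * (g h * indicator {1<..<2} (norm h / t)) \<partial>lborel)"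
    proof (cases "0 < t")
      case True
      have "(\<integral>\<^sup>+v. ennreal (t powr (- 1 - q)) * g (t *\<^sub>R v) * indicator {0<..} t * indicator ?S v \<partial>lborel)
          = (\<integral>\<^sup>+v. ennreal (t powr (- 1 - q)) * (g (t *\<^sub>R v) * indicator {1<..<2} (norm (t *\<^sub>R v) / t)) \<partial>lborel)"
        using True unfolding ind by (intro nn_integral_cong) (simp add: mult_ac)
      also have "\<dots> = ennreal (t powr (- 1 - q)) * (\<integral>\<^sup>+v. g (t *\<^sub>R v) * indicator {1<..<2} (norm (t *\<^sub>R v) / t) \<partial>lborel)"
        by (intro nn_integral_cmult) measurable
      also have "(\<integral>\<^sup>+v. g (t *\<^sub>R v) * indicator {1<..<2} (norm (t *\<^sub>R v) / t) \<partial>lborel)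
          = ennreal (t powr - ?d) * (\<integral>\<^sup>+h. g h * indicator {1<..<2} (norm h / t) \<partial>lborel)"
        by (rule nn_integral_lborel_scaleR[OF _ True]) measurable
      also have "ennreal (t powr (- 1 - q)) * (ennreal (t powr - ?d) * (\<integral>\<^sup>+h. g h * indicator {1<..<2} (norm h / t) \<partial>lborel))
          = ennreal (t powr (- 1 - q - ?d)) * (\<integral>\<^sup>+h. g h * indicator {1<..<2} (norm h / t) \<partial>lborel)"
        by (simp add: mult.assoc[symmetric] ennreal_mult[symmetric] powr_add[symmetric])
      also have "\<dots> = (\<integral>\<^sup>+h. ennreal (t powr (- 1 - q - ?d)) * indicator {0<..} t * (g h * indicator {1<..<2} (norm h / t)) \<partial>lborel)"
        using True by (subst nn_integral_cmult[symmetric]) auto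
      finally show ?thesis .
    qed simp
  qed
  also have "\<dots> = (\<integral>\<^sup>+h. \<integral>\<^sup>+t. ennreal (t powr (- 1 - q - ?d)) * indicator {0<..} t *
      (g h * indicator {1<..<2} (norm h / t)) \<partial>lborel \<partial>lborel)"
    by (rule lborel_pair.Fubini') measurable
  also have "\<dots> \<le> (\<integral>\<^sup>+h. ennreal (2 powr (?d + q)) * (g h * ennreal (1 / norm h powr (?d + q))) \<partial>lborel)"
  proof (intro nn_integral_mono)
    fix h :: 'a
    let ?r = "norm h / 2"
    show "(\<integral>\<^sup>+t. ennreal (t powr (- 1 - q - ?d)) * indicator {0<..} t * (g h * indicator {1<..<2} (norm h / t)) \<partial>lborel)
      \<le> ennreal (2 powr (?d + q)) * (g h * ennreal (1 / norm h powr (?d + q)))"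
    proof (cases "h = 0")
      case False
      have "(\<integral>\<^sup>+t. ennreal (t powr (- 1 - q - ?d)) * indicator {0<..} t * (g h * indicator {1<..<2} (norm h / t)) \<partial>lborel)
          \<le> (\<integral>\<^sup>+t. ennreal (?r powr (- 1 - q - ?d)) * g h * indicator {?r..norm h} t \<partial>lborel)"
      proof (intro nn_integral_mono)
        fix t :: real
        show "ennreal (t powr (- 1 - q - ?d)) * indicator {0<..} t * (g h * indicator {1<..<2} (norm h / t))
          \<le> ennreal (?r powr (- 1 - q - ?d)) * g h * indicator {?r..norm h} t"
        proof (cases "0 < t \<and> ?r < t \<and> t < norm h")
          case True
          then have "t powr (- 1 - q - ?d) \<le> ?r powr (- 1 - q - ?d)"
            using False \<open>0 < q\<close> by (intro powr_mono2') auto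
          with True show ?thesis
            by (auto intro!: mult_right_mono ennreal_leI simp: indicator_def)
        next
          case False
          then show ?thesis by (auto simp: indicator_def field_simps)
        qed
      qed
      also have "\<dots> = ennreal (?r powr (- 1 - q - ?d)) * g h * ennreal ?r"
        by (simp add: nn_integral_cmult_indicator)
      also have "\<dots> = ennreal (?r powr (- 1 - q - ?d) * ?r) * g h"
        by (subst ennreal_mult) (simp_all add: mult_ac)
      also have "?r powr (- 1 - q - ?d) * ?r = ?r powr (- (?d + q))"
        using False powr_add[of ?r "- 1 - q - ?d" 1] by (simp add: algebra_simps)
      also have "\<dots> = 2 powr (?d + q) * (1 / norm h powr (?d + q))"
        using powr_divide[of "norm h" 2 "?d + q"] by (simp only: powr_minus_divide) simp
      also have "ennreal \<dots> * g h = ennreal (2 powr (?d + q)) * (g h * ennreal (1 / norm h powr (?d + q)))"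
        by (subst ennreal_mult) (simp_all add: mult_ac)
      finally show ?thesis .
    qed simp
  qed
  also have "\<dots> = ennreal (2 powr (?d + q)) * (\<integral>\<^sup>+h. g h * ennreal (1 / norm h powr (?d + q)) \<partial>lborel)"
    by (intro nn_integral_cmult) measurable
  finally show ?thesis .
qed


section \<open>The fractional inequality for Lipschitz functions vanishing outside the set\<close>

text \<open>
  The Morrey inequality on the segment from \<open>x\<close> to the exit point, at which \<open>u\<close> vanishes. The
  integral is then enlarged to ranges of \<open>t\<close> and \<open>r\<close> that do not depend on \<open>x\<close>, with indicators
  keeping both points in \<open>\<Omega>\<close>; this makes it possible to integrate over \<open>x\<close> afterwards.
\<close>

lemma power_le_ray_energy:
  fixes u :: "'a::euclidean_space \<Rightarrow> real"
  assumes "open \<Omega>" and D: "\<And>x y. x \<in> \<Omega> \<Longrightarrow> y \<in> \<Omega> \<Longrightarrow> dist x y \<le> D"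
    and lip: "L-lipschitz_on UNIV u" and zero: "\<And>x. x \<notin> \<Omega> \<Longrightarrow> u x = 0"
    and p: "1 < p" "1 / p < s" "s < 1" and \<delta>: "0 < \<delta>" "\<delta> < 1" "4 * \<delta> powr (s - 1 / p) \<le> 1"
    and v: "1 \<le> norm v"
  shows "ennreal (\<bar>u x\<bar> powr p)
    \<le> ennreal (4 powr p * \<delta> powr (- p) * p * (1 - s) * D powr (s * p - 1)) *
      (\<integral>\<^sup>+t. ennreal (t powr (- 1 - s * p)) * indicator {0<..} t *
        (\<integral>\<^sup>+r. ennreal (\<bar>u (x + r *\<^sub>R v + t *\<^sub>R v) - u (x + r *\<^sub>R v)\<bar> powr p) *
           indicator \<Omega> (x + r *\<^sub>R v) * indicator \<Omega> (x + r *\<^sub>R v + t *\<^sub>R v) * indicator {0..D} r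
         \<partial>lborel) \<partial>lborel)"
    (is "_ \<le> ennreal (?c * D powr _) * ?W")
proof (cases "x \<in> \<Omega>")
  case True
  obtain \<tau> where \<tau>: "0 < \<tau>" "\<tau> \<le> D" "x + \<tau> *\<^sub>R v \<notin> \<Omega>"
    and inside: "\<And>r. 0 \<le> r \<Longrightarrow> r < \<tau> \<Longrightarrow> x + r *\<^sub>R v \<in> \<Omega>"
    using exit_time[OF \<open>open \<Omega>\<close> True v D] by metis
  define f where "f r = u (x + r *\<^sub>R v)" for r
  have sp: "1 < s * p" using p by (simp add: field_simps)
  have "(L * norm v)-lipschitz_on UNIV f"
  proof (rule lipschitz_onI)
    fix a b :: real
    have "dist (f a) (f b) \<le> L * dist (x + a *\<^sub>R v) (x + b *\<^sub>R v)"
      unfolding f_def by (rule lipschitz_onD[OF lip]) auto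
    also have "dist (x + a *\<^sub>R v) (x + b *\<^sub>R v) = norm v * dist a b"
      by (simp add: dist_norm scaleR_diff_left[symmetric])
    finally show "dist (f a) (f b) \<le> L * norm v * dist a b" by (simp add: mult.assoc)
  qed (use lipschitz_on_nonneg[OF lip] in simp)
  from fractional_morrey_line[OF this p \<delta> \<tau>(1)]
  have "ennreal (\<bar>u x\<bar> powr p) \<le> ennreal (?c * \<tau> powr (s * p - 1)) * line_energy s p f 0 \<tau>"
    using zero[OF \<tau>(3)] by (simp add: f_def)
  also have "\<dots> \<le> ennreal (?c * D powr (s * p - 1)) * ?W"
  proof (rule mult_mono)
    have "\<tau> powr (s * p - 1) \<le> D powr (s * p - 1)"
      using \<tau> sp by (intro powr_mono2) auto
    then show "ennreal (?c * \<tau> powr (s * p - 1)) \<le> ennreal (?c * D powr (s * p - 1))"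
      using p by (intro ennreal_leI mult_left_mono) auto
    show "line_energy s p f 0 \<tau> \<le> ?W"
      unfolding line_energy_def
    proof (rule nn_integral_mono)
      fix t :: real
      have "(\<integral>\<^sup>+r. ennreal (\<bar>f (r + t) - f r\<bar> powr p) * indicator {0<..<\<tau> - t} r \<partial>lborel)
          \<le> (\<integral>\<^sup>+r. ennreal (\<bar>u (x + r *\<^sub>R v + t *\<^sub>R v) - u (x + r *\<^sub>R v)\<bar> powr p) *
           indicator \<Omega> (x + r *\<^sub>R v) * indicator \<Omega> (x + r *\<^sub>R v + t *\<^sub>R v) * indicator {0..D} r \<partial>lborel)"
        if "0 < t"
      proof (rule nn_integral_mono)
        fix r :: real
        have eq: "x + r *\<^sub>R v + t *\<^sub>R v = x + (r + t) *\<^sub>R v" by (simp add: scaleR_add_left)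
        show "ennreal (\<bar>f (r + t) - f r\<bar> powr p) * indicator {0<..<\<tau> - t} r
          \<le> ennreal (\<bar>u (x + r *\<^sub>R v + t *\<^sub>R v) - u (x + r *\<^sub>R v)\<bar> powr p) *
           indicator \<Omega> (x + r *\<^sub>R v) * indicator \<Omega> (x + r *\<^sub>R v + t *\<^sub>R v) * indicator {0..D} r"
          unfolding eq using that \<tau> inside[of r] inside[of "r + t"]
          by (auto simp: f_def indicator_def)
      qed
      then show "ennreal (t powr (- 1 - s * p)) *
          (\<integral>\<^sup>+r. ennreal (\<bar>f (r + t) - f r\<bar> powr p) * indicator {0<..<\<tau> - t} r \<partial>lborel) * indicator {0<..<\<tau> - 0} t
        \<le> ennreal (t powr (- 1 - s * p)) * indicator {0<..} t *
          (\<integral>\<^sup>+r. ennreal (\<bar>u (x + r *\<^sub>R v + t *\<^sub>R v) - u (x + r *\<^sub>R v)\<bar> powr p) *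
           indicator \<Omega> (x + r *\<^sub>R v) * indicator \<Omega> (x + r *\<^sub>R v + t *\<^sub>R v) * indicator {0..D} r \<partial>lborel)"
        by (cases "t \<in> {0<..<\<tau>}") (auto intro!: mult_left_mono)
    qed
  qed simp_all
  finally show ?thesis .
qed (simp add: zero)

text \<open>
  After integration over \<open>x\<close>, translation by \<open>r v\<close> shows that the inner integral does not depend on
  \<open>r\<close>, so the position on the ray contributes just a factor \<open>D\<close>.
\<close>

lemma Lp_le_directional_energy:
  fixes u :: "'a::euclidean_space \<Rightarrow> real"
  assumes "open \<Omega>" and D: "\<And>x y. x \<in> \<Omega> \<Longrightarrow> y \<in> \<Omega> \<Longrightarrow> dist x y \<le> D" "0 < D"
    and lip: "L-lipschitz_on UNIV u" and zero: "\<And>x. x \<notin> \<Omega> \<Longrightarrow> u x = 0"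
    and p: "1 < p" "1 / p < s" "s < 1" and \<delta>: "0 < \<delta>" "\<delta> < 1" "4 * \<delta> powr (s - 1 / p) \<le> 1"
    and v: "1 \<le> norm v"
  shows "(\<integral>\<^sup>+x. ennreal (\<bar>u x\<bar> powr p) \<partial>lborel)
    \<le> ennreal (4 powr p * \<delta> powr (- p) * p * (1 - s) * D powr (s * p)) *
      (\<integral>\<^sup>+t. ennreal (t powr (- 1 - s * p)) * shift_energy p \<Omega> u (t *\<^sub>R v) * indicator {0<..} t \<partial>lborel)"
proof -
  have [measurable]: "u \<in> borel_measurable borel"
    using lipschitz_on_continuous_on[OF lip] by (rule borel_measurable_continuous_onI)
  have [measurable]: "\<Omega> \<in> sets borel" using \<open>open \<Omega>\<close> by simp
  have [measurable]: "shift_energy p \<Omega> u \<in> borel_measurable borel"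
    by (rule borel_measurable_shift_energy) measurable
  let ?k = "\<lambda>t. ennreal (t powr (- 1 - s * p)) * indicator {0<..} t"
  let ?E = "\<lambda>x h. ennreal (\<bar>u (x + h) - u x\<bar> powr p) * indicator \<Omega> x * indicator \<Omega> (x + h)"
  let ?c = "4 powr p * \<delta> powr (- p) * p * (1 - s)"
  let ?c' = "ennreal (?c * D powr (s * p - 1))"
  have "(\<integral>\<^sup>+x. ennreal (\<bar>u x\<bar> powr p) \<partial>lborel)
      \<le> (\<integral>\<^sup>+x. ?c' * (\<integral>\<^sup>+t. ?k t * (\<integral>\<^sup>+r. ?E (x + r *\<^sub>R v) (t *\<^sub>R v) * indicator {0..D} r \<partial>lborel) \<partial>lborel) \<partial>lborel)"
    by (intro nn_integral_mono power_le_ray_energy[OF \<open>open \<Omega>\<close> D(1) lip zero p \<delta> v])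
  also have "\<dots> = ?c' * (\<integral>\<^sup>+x. \<integral>\<^sup>+t. ?k t * (\<integral>\<^sup>+r. ?E (x + r *\<^sub>R v) (t *\<^sub>R v) * indicator {0..D} r \<partial>lborel) \<partial>lborel \<partial>lborel)"
    by (rule nn_integral_cmult) measurable
  also have "(\<integral>\<^sup>+x. \<integral>\<^sup>+t. ?k t * (\<integral>\<^sup>+r. ?E (x + r *\<^sub>R v) (t *\<^sub>R v) * indicator {0..D} r \<partial>lborel) \<partial>lborel \<partial>lborel)
      = (\<integral>\<^sup>+t. \<integral>\<^sup>+x. ?k t * (\<integral>\<^sup>+r. ?E (x + r *\<^sub>R v) (t *\<^sub>R v) * indicator {0..D} r \<partial>lborel) \<partial>lborel \<partial>lborel)"
    by (rule lborel_pair.Fubini') measurable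
  also have "\<dots> = (\<integral>\<^sup>+t. ?k t * shift_energy p \<Omega> u (t *\<^sub>R v) * ennreal D \<partial>lborel)"
  proof (rule nn_integral_cong)
    fix t :: real
    have "(\<integral>\<^sup>+x. ?k t * (\<integral>\<^sup>+r. ?E (x + r *\<^sub>R v) (t *\<^sub>R v) * indicator {0..D} r \<partial>lborel) \<partial>lborel)
        = ?k t * (\<integral>\<^sup>+x. \<integral>\<^sup>+r. ?E (x + r *\<^sub>R v) (t *\<^sub>R v) * indicator {0..D} r \<partial>lborel \<partial>lborel)"
      by (rule nn_integral_cmult) measurable
    also have "(\<integral>\<^sup>+x. \<integral>\<^sup>+r. ?E (x + r *\<^sub>R v) (t *\<^sub>R v) * indicator {0..D} r \<partial>lborel \<partial>lborel)
        = (\<integral>\<^sup>+r. \<integral>\<^sup>+x. ?E (x + r *\<^sub>R v) (t *\<^sub>R v) * indicator {0..D} r \<partial>lborel \<partial>lborel)"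
      by (rule lborel_pair.Fubini') measurable
    also have "\<dots> = (\<integral>\<^sup>+r. shift_energy p \<Omega> u (t *\<^sub>R v) * indicator {0..D} r \<partial>lborel)"
    proof (rule nn_integral_cong)
      fix r :: real
      have "(\<integral>\<^sup>+x. ?E (x + r *\<^sub>R v) (t *\<^sub>R v) * indicator {0..D} r \<partial>lborel)
          = (\<integral>\<^sup>+x. ?E (x + r *\<^sub>R v) (t *\<^sub>R v) \<partial>lborel) * indicator {0..D} r"
        by (rule nn_integral_multc) measurable
      also have "(\<integral>\<^sup>+x. ?E (x + r *\<^sub>R v) (t *\<^sub>R v) \<partial>lborel) = shift_energy p \<Omega> u (t *\<^sub>R v)"
        unfolding shift_energy_def by (rule nn_integral_lborel_translate[where F = "\<lambda>x. ?E x (t *\<^sub>R v)"]) measurable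
      finally show "(\<integral>\<^sup>+x. ?E (x + r *\<^sub>R v) (t *\<^sub>R v) * indicator {0..D} r \<partial>lborel)
          = shift_energy p \<Omega> u (t *\<^sub>R v) * indicator {0..D} r" .
    qed
    also have "\<dots> = shift_energy p \<Omega> u (t *\<^sub>R v) * ennreal D"
      using \<open>0 < D\<close> by (simp add: nn_integral_cmult_indicator)
    finally show "(\<integral>\<^sup>+x. ?k t * (\<integral>\<^sup>+r. ?E (x + r *\<^sub>R v) (t *\<^sub>R v) * indicator {0..D} r \<partial>lborel) \<partial>lborel)
        = ?k t * shift_energy p \<Omega> u (t *\<^sub>R v) * ennreal D"
      by (simp add: mult.assoc)
  qed
  also have "\<dots> = (\<integral>\<^sup>+t. ?k t * shift_energy p \<Omega> u (t *\<^sub>R v) \<partial>lborel) * ennreal D"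
    by (rule nn_integral_multc) measurable
  also have "?c' * \<dots> = ennreal (?c * D powr (s * p)) * (\<integral>\<^sup>+t. ?k t * shift_energy p \<Omega> u (t *\<^sub>R v) \<partial>lborel)"
  proof -
    have "ennreal (?c * D powr (s * p)) = ?c' * ennreal D"
      using \<open>0 < D\<close> p powr_add[of D "s * p - 1" 1] by (simp add: ennreal_mult[symmetric] mult.assoc)
    then show ?thesis by (simp add: mult_ac)
  qed
  finally show ?thesis by (simp add: mult_ac)
qed

text \<open>
  The bound along a single direction holds for every \<open>v\<close> in the shell; averaging over the shell gives
  the Gagliardo energy.
\<close>

lemma fractional_poincare_lipschitz:
  fixes u :: "'a::euclidean_space \<Rightarrow> real"
  assumes "open \<Omega>" and D: "\<And>x y. x \<in> \<Omega> \<Longrightarrow> y \<in> \<Omega> \<Longrightarrow> dist x y \<le> D" "0 < D"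
    and lip: "L-lipschitz_on UNIV u" and zero: "\<And>x. x \<notin> \<Omega> \<Longrightarrow> u x = 0"
    and p: "1 < p" "1 / p < s" "s < 1" and \<delta>: "0 < \<delta>" "\<delta> < 1" "4 * \<delta> powr (s - 1 / p) \<le> 1"
  shows "emeasure lborel {v::'a. 1 < norm v \<and> norm v < 2} * Lp_energy p \<Omega> u
    \<le> ennreal (4 powr p * \<delta> powr (- p) * p * (1 - s) * D powr (s * p) * 2 powr (real DIM('a) + s * p)) *
       gagliardo_energy s p \<Omega> u"
proof -
  have [measurable]: "u \<in> borel_measurable borel"
    using lipschitz_on_continuous_on[OF lip] by (rule borel_measurable_continuous_onI)
  have [measurable]: "\<Omega> \<in> sets borel" using \<open>open \<Omega>\<close> by simp
  have [measurable]: "shift_energy p \<Omega> u \<in> borel_measurable borel"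
    by (rule borel_measurable_shift_energy) measurable
  let ?S = "{v::'a. 1 < norm v \<and> norm v < 2}"
  have [measurable]: "?S \<in> sets borel" by measurable
  let ?c = "4 powr p * \<delta> powr (- p) * p * (1 - s) * D powr (s * p)"
  let ?R = "\<lambda>v. \<integral>\<^sup>+t. ennreal (t powr (- 1 - s * p)) * shift_energy p \<Omega> u (t *\<^sub>R v) * indicator {0<..} t \<partial>lborel"
  have "0 < s * p" using p by (smt (verit) divide_pos_pos mult_pos_pos)
  have "Lp_energy p \<Omega> u = (\<integral>\<^sup>+x. ennreal (\<bar>u x\<bar> powr p) \<partial>lborel)"
    unfolding Lp_energy_def
    by (simp add: nn_integral_restrict_space nn_integral_completion)
       (intro nn_integral_cong, auto simp: indicator_def zero)
  then have "emeasure lborel ?S * Lp_energy p \<Omega> u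
      = (\<integral>\<^sup>+v. (\<integral>\<^sup>+x. ennreal (\<bar>u x\<bar> powr p) \<partial>lborel) * indicator ?S v \<partial>lborel)"
    by (simp add: nn_integral_cmult_indicator mult.commute)
  also have "\<dots> \<le> (\<integral>\<^sup>+v. ennreal ?c * (?R v * indicator ?S v) \<partial>lborel)"
    using Lp_le_directional_energy[OF \<open>open \<Omega>\<close> D lip zero p \<delta>]
    by (intro nn_integral_mono) (auto simp: indicator_def)
  also have "\<dots> = ennreal ?c * (\<integral>\<^sup>+v. ?R v * indicator ?S v \<partial>lborel)"
    by (rule nn_integral_cmult) measurable
  also have "\<dots> \<le> ennreal ?c * (ennreal (2 powr (real DIM('a) + s * p)) * gagliardo_energy s p \<Omega> u)"
    using \<open>0 < s * p\<close>
    by (subst gagliardo_energy_eq_shift_energy) (auto intro!: mult_left_mono nn_integral_shell_rays_le)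
  also have "\<dots> = ennreal (?c * 2 powr (real DIM('a) + s * p)) * gagliardo_energy s p \<Omega> u"
    using p by (simp add: ennreal_mult mult.assoc)
  finally show ?thesis .
qed


section \<open>Calculus of smooth functions with compact support\<close>

lemma frechet_derivative_apply:
  assumes "(f has_derivative f') (at x)"
  shows "frechet_derivative f (at x) b = f' b"
  using frechet_derivative_at[OF assms] by simp

lemma Ck_SucI:
  assumes "\<And>x. (f has_derivative f' x) (at x)" "\<And>b. b \<in> Basis \<Longrightarrow> Ck k (\<lambda>x. f' x b)"
  shows "Ck (Suc k) f"
  using assms by (auto simp: frechet_derivative_apply[OF assms(1)] differentiable_def)

lemma Ck_Suc_has_derivative:
  "Ck (Suc k) f \<Longrightarrow> (f has_derivative frechet_derivative f (at x)) (at x)"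
  by (simp add: frechet_derivative_works[symmetric])

lemma Ck_Suc_partial: "Ck (Suc k) f \<Longrightarrow> b \<in> Basis \<Longrightarrow> Ck k (\<lambda>x. frechet_derivative f (at x) b)"
  by simp

lemma Ck_Suc_imp_Ck: "Ck (Suc k) f \<Longrightarrow> Ck k f"
proof (induction k arbitrary: f)
  case 0
  then show ?case
    by (auto intro!: continuous_at_imp_continuous_on differentiable_imp_continuous_within)
qed auto

lemma Ck_const: "Ck k (\<lambda>x. c)"
proof (induction k arbitrary: c)
  case (Suc k)
  then show ?case by (intro Ck_SucI[OF has_derivative_const])
qed simp

lemma Ck_inner_left: "Ck k (\<lambda>x. x \<bullet> c)"
proof (cases k)
  case (Suc j)
  have "((\<lambda>x. x \<bullet> c) has_derivative (\<lambda>h. h \<bullet> c)) (at x)" for x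
    by (auto intro!: derivative_eq_intros)
  then show ?thesis unfolding Suc by (intro Ck_SucI[OF _ Ck_const])
qed (auto intro!: continuous_intros)

lemma Ck_add:
  assumes "Ck k f" "Ck k g" shows "Ck k (\<lambda>x. f x + g x)"
  using assms
proof (induction k arbitrary: f g)
  case (Suc k)
  show ?case
    by (rule Ck_SucI[OF has_derivative_add[OF Suc.prems[THEN Ck_Suc_has_derivative]]])
       (intro Suc.IH Suc.prems[THEN Ck_Suc_partial])
qed (auto intro: continuous_intros)

lemma Ck_mult:
  assumes "Ck k f" "Ck k g" shows "Ck k (\<lambda>x. f x * g x)"
  using assms
proof (induction k arbitrary: f g)
  case (Suc k)
  show ?case
    by (rule Ck_SucI[OF has_derivative_mult[OF Suc.prems[THEN Ck_Suc_has_derivative]]])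
       (intro Ck_add Suc.IH Suc.prems[THEN Ck_Suc_partial] Suc.prems[THEN Ck_Suc_imp_Ck])
qed (auto intro: continuous_intros)

lemma has_derivative_powr_const:
  fixes F :: "'a::real_normed_vector \<Rightarrow> real"
  assumes "(F has_derivative F') (at x)" "0 < F x"
  shows "((\<lambda>x. F x powr q) has_derivative (\<lambda>h. q * F x powr (q - 1) * F' h)) (at x)"
  using has_derivative_compose[OF assms(1)
      has_field_derivative_imp_has_derivative[OF has_real_derivative_powr[OF assms(2)]]]
  by simp

lemma Ck_powr:
  assumes "Ck k F" "\<And>x. 0 < F x" shows "Ck k (\<lambda>x. F x powr q)"
  using assms(1)
proof (induction k arbitrary: q)
  case 0
  then show ?case using assms(2) by (auto intro!: continuous_intros simp: less_imp_neq[symmetric])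
next
  case (Suc k)
  show ?case
    by (rule Ck_SucI[OF has_derivative_powr_const[OF Suc.prems[THEN Ck_Suc_has_derivative] assms(2)]])
       (intro Ck_mult Ck_const Suc.IH Suc.prems[THEN Ck_Suc_partial] Suc.prems[THEN Ck_Suc_imp_Ck])
qed

lemma test_function_has_derivative:
  assumes "\<phi> \<in> test_functions \<Omega>"
  shows "(\<phi> has_derivative frechet_derivative \<phi> (at x)) (at x)"
proof -
  have "Ck (Suc 0) \<phi>" using assms by (simp only: test_functions_def mem_Collect_eq)
  then show ?thesis by (simp add: frechet_derivative_works[symmetric])
qed

lemma continuous_on_test_function:
  assumes "\<phi> \<in> test_functions \<Omega>" shows "continuous_on S \<phi>"
proof -
  have "Ck 0 \<phi>" using assms by (simp only: test_functions_def mem_Collect_eq)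
  then show ?thesis by (auto intro: continuous_on_subset)
qed

lemma continuous_on_test_function_partial:
  assumes "\<phi> \<in> test_functions \<Omega>" "b \<in> Basis"
  shows "continuous_on S (\<lambda>x. frechet_derivative \<phi> (at x) b)"
proof -
  have "Ck (Suc 0) \<phi>" using assms by (simp only: test_functions_def mem_Collect_eq)
  then show ?thesis using assms(2) by (auto intro: continuous_on_subset)
qed

lemma test_function_eq_0:
  assumes "x \<notin> closure {x. \<phi> x \<noteq> 0}" shows "\<phi> x = 0"
  using assms closure_subset[of "{x. \<phi> x \<noteq> 0}"] by auto

lemma test_function_partial_eq_0:
  fixes \<phi> :: "'a::euclidean_space \<Rightarrow> real"
  assumes "x \<notin> closure {x. \<phi> x \<noteq> 0}"
  shows "frechet_derivative \<phi> (at x) b = 0"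
proof -
  have "(\<phi> has_derivative (\<lambda>h. 0)) (at x)"
  proof (rule has_derivative_transform_within_open[OF has_derivative_const[where c = 0]])
    show "open (- closure {x. \<phi> x \<noteq> 0})" "x \<in> - closure {x. \<phi> x \<noteq> 0}"
      using assms by auto
    show "0 = \<phi> y" if "y \<in> - closure {x. \<phi> x \<noteq> 0}" for y
      using that test_function_eq_0[of y \<phi>] by simp
  qed
  then show ?thesis by (simp add: frechet_derivative_apply)
qed

lemma test_functions_subsupport:
  assumes "\<phi> \<in> test_functions \<Omega>" "\<And>k. Ck k \<psi>" "\<And>x. \<phi> x = 0 \<Longrightarrow> \<psi> x = 0"
  shows "\<psi> \<in> test_functions \<Omega>"
proof -
  have "closure {x. \<psi> x \<noteq> 0} \<subseteq> closure {x. \<phi> x \<noteq> 0}"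
    using assms(3) by (intro closure_mono) auto
  then show ?thesis
    using assms(1,2) unfolding test_functions_def
    using compact_Int_closed[of "closure {x. \<phi> x \<noteq> 0}" "closure {x. \<psi> x \<noteq> 0}"]
    by (auto simp: Int_absorb1)
qed

lemma compactly_supported_bounded:
  fixes f :: "'a::euclidean_space \<Rightarrow> real"
  assumes "continuous_on UNIV f" "compact K" "\<And>x. x \<notin> K \<Longrightarrow> f x = 0"
  obtains M where "0 \<le> M" "\<And>x. \<bar>f x\<bar> \<le> M"
proof -
  have "bounded (f ` K)"
    using assms by (intro compact_imp_bounded compact_continuous_image) (auto intro: continuous_on_subset)
  then obtain M where "\<And>x. x \<in> K \<Longrightarrow> \<bar>f x\<bar> \<le> M" by (auto simp: bounded_iff)
  then have "\<bar>f x\<bar> \<le> max M 0" for x using assms(3)[of x] by (cases "x \<in> K") fastforce+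
  then show ?thesis using that[of "max M 0"] by simp
qed

text \<open>
  The partial derivatives are continuous and vanish outside a compact set, hence bounded.
\<close>

lemma test_function_lipschitz:
  fixes \<phi> :: "'a::euclidean_space \<Rightarrow> real"
  assumes \<phi>: "\<phi> \<in> test_functions \<Omega>"
  obtains L where "L-lipschitz_on UNIV \<phi>"
proof -
  have K: "compact (closure {x. \<phi> x \<noteq> 0})" using \<phi> by (simp add: test_functions_def)
  have "\<forall>b\<in>Basis. \<exists>M. 0 \<le> M \<and> (\<forall>x. \<bar>frechet_derivative \<phi> (at x) b\<bar> \<le> M)"
    using compactly_supported_bounded[OF continuous_on_test_function_partial[OF \<phi>] K test_function_partial_eq_0]
    by metis
  then obtain M where M: "\<And>b. b \<in> Basis \<Longrightarrow> 0 \<le> M b"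
      "\<And>b x. b \<in> Basis \<Longrightarrow> \<bar>frechet_derivative \<phi> (at x) b\<bar> \<le> M b"
    by metis
  have "onorm (frechet_derivative \<phi> (at x)) \<le> (\<Sum>b\<in>Basis. M b)" for x
  proof (rule onorm_bound)
    fix h :: 'a
    have lin: "linear (frechet_derivative \<phi> (at x))"
      using test_function_has_derivative[OF \<phi>] by (rule has_derivative_linear)
    have "frechet_derivative \<phi> (at x) h = frechet_derivative \<phi> (at x) (\<Sum>b\<in>Basis. (h \<bullet> b) *\<^sub>R b)"
      by (simp add: euclidean_representation)
    also have "\<dots> = (\<Sum>b\<in>Basis. (h \<bullet> b) * frechet_derivative \<phi> (at x) b)"
      using lin by (simp add: linear_sum linear_scale)
    finally have "norm (frechet_derivative \<phi> (at x) h) \<le> (\<Sum>b\<in>Basis. \<bar>(h \<bullet> b) * frechet_derivative \<phi> (at x) b\<bar>)"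
      by (simp add: sum_abs)
    also have "\<dots> \<le> (\<Sum>b\<in>Basis. norm h * M b)"
      using M by (intro sum_mono) (auto simp: abs_mult intro!: mult_mono Basis_le_norm)
    finally show "norm (frechet_derivative \<phi> (at x) h) \<le> (\<Sum>b\<in>Basis. M b) * norm h"
      by (simp add: sum_distrib_left mult.commute)
  qed (simp add: M sum_nonneg)
  then have "norm (\<phi> x - \<phi> y) \<le> (\<Sum>b\<in>Basis. M b) * norm (x - y)" for x y
    using test_function_has_derivative[OF \<phi>]
    by (intro differentiable_bound[where S = UNIV and f' = "\<lambda>x. frechet_derivative \<phi> (at x)"]) auto
  then have "(\<Sum>b\<in>Basis. M b)-lipschitz_on UNIV \<phi>"
    by (intro lipschitz_onI) (auto simp: dist_norm M sum_nonneg)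
  then show ?thesis by (rule that)
qed

lemma integrable_compactly_supported:
  fixes f :: "'a::euclidean_space \<Rightarrow> 'b::euclidean_space"
  assumes "continuous_on UNIV f" "compact K" "\<And>x. x \<notin> K \<Longrightarrow> f x = 0"
  shows "integrable lborel f"
proof -
  have "integrable lborel (\<lambda>x. indicator K x *\<^sub>R f x)"
    using assms by (intro borel_integrable_compact) (auto intro: continuous_on_subset)
  also have "(\<lambda>x. indicator K x *\<^sub>R f x) = f" using assms(3) by (auto simp: indicator_def fun_eq_iff)
  finally show ?thesis .
qed

lemma
  fixes f :: "'a::euclidean_space \<Rightarrow> 'b::euclidean_space"
  assumes "f \<in> borel_measurable borel" "open \<Omega>" "\<And>x. x \<notin> \<Omega> \<Longrightarrow> f x = 0"
  shows integral_lebesgue_on_eq_lborel: "(\<integral>x. f x \<partial>lebesgue_on \<Omega>) = (\<integral>x. f x \<partial>lborel)"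
    and integrable_lebesgue_on_eq_lborel: "integrable (lebesgue_on \<Omega>) f \<longleftrightarrow> integrable lborel f"
proof -
  have "(\<lambda>x. indicator \<Omega> x *\<^sub>R f x) = f" using assms(3) by (auto simp: indicator_def fun_eq_iff)
  then show "(\<integral>x. f x \<partial>lebesgue_on \<Omega>) = (\<integral>x. f x \<partial>lborel)"
      "integrable (lebesgue_on \<Omega>) f \<longleftrightarrow> integrable lborel f"
    using assms(1,2) by (simp_all add: integral_restrict_space integrable_restrict_space
        integral_completion integrable_completion)
qed

text \<open>
  The difference quotients have integral zero because Lebesgue measure is translation invariant. They
  are bounded by the Lipschitz constant and supported in a fixed ball, so dominated convergence applies.
\<close>

lemma integral_test_function_partial_eq_0:
  fixes \<phi> :: "'a::euclidean_space \<Rightarrow> real"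
  assumes \<phi>: "\<phi> \<in> test_functions \<Omega>" and b: "b \<in> Basis"
  shows "(\<integral>x. frechet_derivative \<phi> (at x) b \<partial>lborel) = 0"
proof -
  have K: "compact (closure {x. \<phi> x \<noteq> 0})" using \<phi> by (simp add: test_functions_def)
  then obtain R where R: "\<And>x. x \<in> closure {x. \<phi> x \<noteq> 0} \<Longrightarrow> norm x \<le> R"
    by (meson bounded_iff compact_imp_bounded)
  obtain L where lip: "L-lipschitz_on UNIV \<phi>" using test_function_lipschitz[OF \<phi>] .
  have [measurable]: "\<phi> \<in> borel_measurable borel"
    using continuous_on_test_function[OF \<phi>] by (rule borel_measurable_continuous_onI)
  have [measurable]: "(\<lambda>x. frechet_derivative \<phi> (at x) b) \<in> borel_measurable borel"
    using continuous_on_test_function_partial[OF \<phi> b] by (rule borel_measurable_continuous_onI)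
  have int: "integrable lborel \<phi>"
    using continuous_on_test_function[OF \<phi>] K test_function_eq_0 by (rule integrable_compactly_supported)
  define e where "e n = inverse (real (Suc n))" for n
  have e: "0 < e n" "e n \<le> 1" for n by (auto simp: e_def inverse_le_1_iff)
  define q where "q n x = (\<phi> (x + e n *\<^sub>R b) - \<phi> x) / e n" for n x
  have "(\<integral>x. q n x \<partial>lborel) = 0" for n
  proof -
    have shift: "integrable lborel (\<lambda>x. \<phi> (x + e n *\<^sub>R b))"
        "(\<integral>x. \<phi> (x + e n *\<^sub>R b) \<partial>lborel) = (\<integral>x. \<phi> x \<partial>lborel)"
    proof -
      have "integrable (distr lborel borel ((+) (e n *\<^sub>R b))) \<phi>"
        using int by (simp add: lborel_distr_plus)
      then show "integrable lborel (\<lambda>x. \<phi> (x + e n *\<^sub>R b))"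
        by (subst (asm) integrable_distr_eq) (auto simp: add.commute)
      have "(\<integral>x. \<phi> x \<partial>lborel) = (\<integral>x. \<phi> x \<partial>distr lborel borel ((+) (e n *\<^sub>R b)))"
        by (simp add: lborel_distr_plus)
      also have "\<dots> = (\<integral>x. \<phi> (x + e n *\<^sub>R b) \<partial>lborel)"
        by (subst integral_distr) (auto simp: add.commute)
      finally show "(\<integral>x. \<phi> (x + e n *\<^sub>R b) \<partial>lborel) = (\<integral>x. \<phi> x \<partial>lborel)" ..
    qed
    show ?thesis unfolding q_def using shift int by simp
  qed
  moreover have "(\<lambda>n. \<integral>x. q n x \<partial>lborel) \<longlonglongrightarrow> (\<integral>x. frechet_derivative \<phi> (at x) b \<partial>lborel)"
  proof (rule integral_dominated_convergence)
    show "integrable lborel (\<lambda>x::'a. indicator (cball 0 (R + 1)) x * L :: real)"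
      using emeasure_bounded_finite[of "cball (0::'a) (R + 1)"]
      by (intro integrable_mult_left integrable_real_indicator) auto
    show "AE x in lborel. norm (q n x) \<le> indicator (cball 0 (R + 1)) x * L" for n
    proof (rule AE_I2)
      fix x
      have "\<bar>\<phi> (x + e n *\<^sub>R b) - \<phi> x\<bar> \<le> L * e n"
        using lipschitz_onD[OF lip, of "x + e n *\<^sub>R b" x] e[of n] b by (simp add: dist_norm)
      then have "norm (q n x) \<le> L" using e[of n] by (simp add: q_def divide_le_eq)
      moreover have "q n x = 0" if "x \<notin> cball 0 (R + 1)"
      proof -
        have "norm x \<le> norm (x + e n *\<^sub>R b) + norm (e n *\<^sub>R b)"
          using norm_triangle_ineq4[of "x + e n *\<^sub>R b" "e n *\<^sub>R b"] by simp
        then have "R < norm (x + e n *\<^sub>R b)" "R < norm x" using that e[of n] b by auto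
        then have "\<phi> (x + e n *\<^sub>R b) = 0" "\<phi> x = 0"
          using R by (force intro: test_function_eq_0)+
        then show ?thesis by (simp add: q_def)
      qed
      ultimately show "norm (q n x) \<le> indicator (cball 0 (R + 1)) x * L"
        by (auto simp: indicator_def)
    qed
    show "AE x in lborel. (\<lambda>n. q n x) \<longlonglongrightarrow> frechet_derivative \<phi> (at x) b"
    proof (rule AE_I2)
      fix x
      have "((\<lambda>t. x + t *\<^sub>R b) has_derivative (\<lambda>t. t *\<^sub>R b)) (at 0)"
        by (auto intro!: derivative_eq_intros)
      moreover have "(\<phi> has_derivative frechet_derivative \<phi> (at x)) (at (x + 0 *\<^sub>R b))"
        using test_function_has_derivative[OF \<phi>] by simp
      ultimately have "((\<lambda>t. \<phi> (x + t *\<^sub>R b)) has_derivative (\<lambda>t. frechet_derivative \<phi> (at x) (t *\<^sub>R b))) (at 0)"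
        by (rule has_derivative_compose)
      moreover have "(\<lambda>t. frechet_derivative \<phi> (at x) (t *\<^sub>R b)) = (*) (frechet_derivative \<phi> (at x) b)"
        using has_derivative_linear[OF test_function_has_derivative[OF \<phi>]]
        by (simp add: fun_eq_iff linear_scale mult.commute)
      ultimately have "((\<lambda>t. \<phi> (x + t *\<^sub>R b)) has_real_derivative frechet_derivative \<phi> (at x) b) (at 0)"
        by (simp add: has_field_derivative_def)
      then have "((\<lambda>t. (\<phi> (x + t *\<^sub>R b) - \<phi> x) / t) \<longlongrightarrow> frechet_derivative \<phi> (at x) b) (at 0)"
        by (simp add: has_field_derivative_iff)
      moreover have "e \<longlonglongrightarrow> 0"
        unfolding e_def[abs_def] by (rule LIMSEQ_inverse_real_of_nat)
      then have "filterlim e (at 0) sequentially"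
        using e(1) by (auto simp: filterlim_at less_imp_neq[symmetric])
      ultimately show "(\<lambda>n. q n x) \<longlonglongrightarrow> frechet_derivative \<phi> (at x) b"
        unfolding q_def by (rule filterlim_compose)
    qed
  qed (simp_all add: q_def)
  ultimately show ?thesis by (simp add: LIMSEQ_const_iff)
qed


section \<open>Weak gradients\<close>

lemma continuous_imp_borel_measurable_lebesgue_on:
  fixes f :: "'a::euclidean_space \<Rightarrow> 'b::euclidean_space"
  assumes "continuous_on UNIV f" shows "f \<in> borel_measurable (lebesgue_on S)"
  using borel_measurable_continuous_onI[OF assms]
  by (intro measurable_restrict_space1 measurable_completion) simp

lemma continuous_integrable_lebesgue_on_compact:
  fixes f :: "'a::euclidean_space \<Rightarrow> 'b::euclidean_space"
  assumes "continuous_on UNIV f" "compact K"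
  shows "integrable (lebesgue_on K) f"
proof -
  have "integrable lborel (\<lambda>x. indicator K x *\<^sub>R f x)"
    using assms by (intro borel_integrable_compact) (auto intro: continuous_on_subset)
  then have "integrable lebesgue (\<lambda>x. indicator K x *\<^sub>R f x)"
    by (subst integrable_completion) auto
  then show ?thesis
    using borel_compact[OF \<open>compact K\<close>] by (subst integrable_restrict_space) auto
qed

lemma integrable_mult_compactly_supported:
  fixes u w :: "'a::euclidean_space \<Rightarrow> real"
  assumes u: "integrable (lebesgue_on K) u" and w: "continuous_on UNIV w" "\<And>x. x \<notin> K \<Longrightarrow> w x = 0"
    and K: "compact K" "K \<subseteq> \<Omega>" and "open \<Omega>"
  shows "integrable (lebesgue_on \<Omega>) (\<lambda>x. u x * w x)"
proof -
  obtain M where M: "0 \<le> M" "\<And>x. \<bar>w x\<bar> \<le> M"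
    using compactly_supported_bounded[OF w(1) K(1) w(2)] by metis
  have [measurable]: "w \<in> borel_measurable (lebesgue_on K)"
    using w(1) by (rule continuous_imp_borel_measurable_lebesgue_on)
  have [measurable]: "u \<in> borel_measurable (lebesgue_on K)" using u by simp
  have "integrable (lebesgue_on K) (\<lambda>x. u x * w x)"
  proof (rule Bochner_Integration.integrable_bound)
    show "integrable (lebesgue_on K) (\<lambda>x. u x * M)" using u by simp
    show "AE x in lebesgue_on K. norm (u x * w x) \<le> norm (u x * M)"
      using M by (intro AE_I2) (auto simp: abs_mult intro!: mult_left_mono)
  qed measurable
  then have "integrable lebesgue (\<lambda>x. indicator K x *\<^sub>R (u x * w x))"
    using borel_compact[OF K(1)] by (subst (asm) integrable_restrict_space) auto
  also have "(\<lambda>x. indicator K x *\<^sub>R (u x * w x)) = (\<lambda>x. indicator \<Omega> x *\<^sub>R (u x * w x))"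
    using w(2) K(2) by (auto simp: indicator_def fun_eq_iff)
  finally show ?thesis
    using \<open>open \<Omega>\<close> by (subst integrable_restrict_space) auto
qed

lemma weak_gradient_pairing_integrable:
  fixes u :: "'a::euclidean_space \<Rightarrow> real"
  assumes G: "has_weak_gradient \<Omega> u G" and "open \<Omega>" and \<psi>: "\<psi> \<in> test_functions \<Omega>" and b: "b \<in> Basis"
  shows "integrable (lebesgue_on \<Omega>) (\<lambda>x. u x * frechet_derivative \<psi> (at x) b)"
    and "integrable (lebesgue_on \<Omega>) (\<lambda>x. (G x \<bullet> b) * \<psi> x)"
proof -
  let ?K = "closure {x. \<psi> x \<noteq> 0}"
  have K: "compact ?K" "?K \<subseteq> \<Omega>" using \<psi> by (simp_all add: test_functions_def)
  with G have "integrable (lebesgue_on ?K) u" "integrable (lebesgue_on ?K) G"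
    by (auto simp: has_weak_gradient_def)
  then show "integrable (lebesgue_on \<Omega>) (\<lambda>x. u x * frechet_derivative \<psi> (at x) b)"
      "integrable (lebesgue_on \<Omega>) (\<lambda>x. (G x \<bullet> b) * \<psi> x)"
    using \<psi> b K \<open>open \<Omega>\<close>
    by (intro integrable_mult_compactly_supported[of ?K] integrable_inner_left
        continuous_on_test_function_partial continuous_on_test_function
        test_function_partial_eq_0 test_function_eq_0; simp)+
qed

lemma has_weak_gradient_diff:
  fixes u v :: "'a::euclidean_space \<Rightarrow> real"
  assumes u: "has_weak_gradient \<Omega> u G" and v: "has_weak_gradient \<Omega> v H" and "open \<Omega>"
  shows "has_weak_gradient \<Omega> (\<lambda>x. u x - v x) (\<lambda>x. G x - H x)"
  unfolding has_weak_gradient_def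
proof (intro conjI allI impI ballI)
  fix K assume "compact K \<and> K \<subseteq> \<Omega>"
  then show "integrable (lebesgue_on K) (\<lambda>x. u x - v x)" "integrable (lebesgue_on K) (\<lambda>x. G x - H x)"
    using u v by (auto simp: has_weak_gradient_def)
next
  fix \<psi> :: "'a \<Rightarrow> real" and b :: 'a
  assume \<psi>: "\<psi> \<in> test_functions \<Omega>" "b \<in> Basis"
  note int = weak_gradient_pairing_integrable[OF u \<open>open \<Omega>\<close> \<psi>] weak_gradient_pairing_integrable[OF v \<open>open \<Omega>\<close> \<psi>]
  show "(\<integral>x. (u x - v x) * frechet_derivative \<psi> (at x) b \<partial>lebesgue_on \<Omega>)
      = - (\<integral>x. ((G x - H x) \<bullet> b) * \<psi> x \<partial>lebesgue_on \<Omega>)"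
    using u v \<psi> int by (simp add: has_weak_gradient_def inner_diff_left left_diff_distrib)
qed

lemma test_function_borel_measurable:
  "\<phi> \<in> test_functions \<Omega> \<Longrightarrow> \<phi> \<in> borel_measurable borel"
  by (intro borel_measurable_continuous_onI continuous_on_test_function)

lemma test_function_partial_borel_measurable:
  "\<phi> \<in> test_functions \<Omega> \<Longrightarrow> b \<in> Basis \<Longrightarrow> (\<lambda>x. frechet_derivative \<phi> (at x) b) \<in> borel_measurable borel"
  by (intro borel_measurable_continuous_onI continuous_on_test_function_partial)

lemma test_function_outside:
  assumes "\<phi> \<in> test_functions \<Omega>" "x \<notin> \<Omega>"
  shows "\<phi> x = 0" "frechet_derivative \<phi> (at x) b = 0"
proof -
  have x: "x \<notin> closure {x. \<phi> x \<noteq> 0}" using assms by (auto simp: test_functions_def)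
  show "\<phi> x = 0" using x by (rule test_function_eq_0)
  show "frechet_derivative \<phi> (at x) b = 0" using x by (rule test_function_partial_eq_0)
qed

lemma integral_partial_lebesgue_on_eq_0:
  assumes "\<phi> \<in> test_functions \<Omega>" "b \<in> Basis" "open \<Omega>"
  shows "(\<integral>x. frechet_derivative \<phi> (at x) b \<partial>lebesgue_on \<Omega>) = 0"
  using integral_lebesgue_on_eq_lborel[OF test_function_partial_borel_measurable[OF assms(1,2)] assms(3)
      test_function_outside(2)[OF assms(1)]]
    integral_test_function_partial_eq_0[OF assms(1,2)]
  by simp

lemma has_weak_gradient_test_function:
  fixes \<phi> :: "'a::euclidean_space \<Rightarrow> real"
  assumes \<phi>: "\<phi> \<in> test_functions \<Omega>" and "open \<Omega>"
  shows "has_weak_gradient \<Omega> \<phi> (\<lambda>x. \<Sum>b\<in>Basis. frechet_derivative \<phi> (at x) b *\<^sub>R b)"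
    (is "has_weak_gradient \<Omega> \<phi> ?G")
  unfolding has_weak_gradient_def
proof (intro conjI allI impI ballI)
  have G: "continuous_on UNIV ?G"
    by (intro continuous_on_sum continuous_on_scaleR continuous_on_const continuous_on_test_function_partial[OF \<phi>])
  fix K assume "compact K \<and> K \<subseteq> \<Omega>"
  then show "integrable (lebesgue_on K) \<phi>" "integrable (lebesgue_on K) ?G"
    using continuous_integrable_lebesgue_on_compact[OF continuous_on_test_function[OF \<phi>]]
      continuous_integrable_lebesgue_on_compact[OF G] by auto
next
  fix \<psi> :: "'a \<Rightarrow> real" and b :: 'a
  assume \<psi>: "\<psi> \<in> test_functions \<Omega>" and b: "b \<in> Basis"
  have prod: "(\<lambda>x. \<phi> x * \<psi> x) \<in> test_functions \<Omega>"
    by (rule test_functions_subsupport[OF \<phi>]) (use \<phi> \<psi> in \<open>simp_all add: test_functions_def Ck_mult\<close>)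
  have deriv: "frechet_derivative (\<lambda>x. \<phi> x * \<psi> x) (at x) b
      = \<phi> x * frechet_derivative \<psi> (at x) b + frechet_derivative \<phi> (at x) b * \<psi> x" for x
    by (rule frechet_derivative_apply[OF has_derivative_mult[OF
          test_function_has_derivative[OF \<phi>] test_function_has_derivative[OF \<psi>]]])
  have Gb: "?G x \<bullet> b = frechet_derivative \<phi> (at x) b" for x
    using b by (simp add: inner_sum_left inner_Basis if_distrib cong: if_cong)
  have K: "compact (closure {x. \<phi> x \<noteq> 0})" "closure {x. \<phi> x \<noteq> 0} \<subseteq> \<Omega>"
    using \<phi> by (simp_all add: test_functions_def)
  have "integrable (lebesgue_on (closure {x. \<phi> x \<noteq> 0})) (\<lambda>x. frechet_derivative \<psi> (at x) b)"
    by (rule continuous_integrable_lebesgue_on_compact[OF continuous_on_test_function_partial[OF \<psi> b] K(1)])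
  from integrable_mult_compactly_supported[OF this continuous_on_test_function[OF \<phi>] test_function_eq_0[of _ \<phi>] K \<open>open \<Omega>\<close>]
  have int1: "integrable (lebesgue_on \<Omega>) (\<lambda>x. \<phi> x * frechet_derivative \<psi> (at x) b)"
    by (simp add: mult.commute)
  have "integrable (lebesgue_on (closure {x. \<phi> x \<noteq> 0})) \<psi>"
    by (rule continuous_integrable_lebesgue_on_compact[OF continuous_on_test_function[OF \<psi>] K(1)])
  from integrable_mult_compactly_supported[OF this continuous_on_test_function_partial[OF \<phi> b]
      test_function_partial_eq_0[of _ \<phi> b] K \<open>open \<Omega>\<close>]
  have int2: "integrable (lebesgue_on \<Omega>) (\<lambda>x. frechet_derivative \<phi> (at x) b * \<psi> x)"
    by (simp add: mult.commute)
  have "0 = (\<integral>x. frechet_derivative (\<lambda>x. \<phi> x * \<psi> x) (at x) b \<partial>lebesgue_on \<Omega>)"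
    by (rule integral_partial_lebesgue_on_eq_0[OF prod b \<open>open \<Omega>\<close>, symmetric])
  also have "\<dots> = (\<integral>x. \<phi> x * frechet_derivative \<psi> (at x) b \<partial>lebesgue_on \<Omega>)
      + (\<integral>x. frechet_derivative \<phi> (at x) b * \<psi> x \<partial>lebesgue_on \<Omega>)"
    unfolding deriv using int1 int2 by (rule Bochner_Integration.integral_add)
  finally show "(\<integral>x. \<phi> x * frechet_derivative \<psi> (at x) b \<partial>lebesgue_on \<Omega>)
      = - (\<integral>x. (?G x \<bullet> b) * \<psi> x \<partial>lebesgue_on \<Omega>)"
    by (simp only: Gb)
qed

text \<open>
  Integrability is only known on compact subsets, but countably many of them exhaust \<open>\<Omega>\<close>.
\<close>

lemma has_weak_gradient_measurable:
  fixes u :: "'a::euclidean_space \<Rightarrow> real"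
  assumes G: "has_weak_gradient \<Omega> u G" and "open \<Omega>"
  shows "G \<in> borel_measurable (lebesgue_on \<Omega>)"
proof -
  obtain C :: "nat \<Rightarrow> 'a set" where C: "\<And>n. compact (C n)" "\<And>n. C n \<subseteq> \<Omega>" "\<Union>(range C) = \<Omega>"
    using open_Union_compact_subsets[OF \<open>open \<Omega>\<close>] by metis
  show ?thesis
  proof (rule measurable_piecewise_restrict[of "range C"])
    fix K assume "K \<in> range C"
    then have K: "compact K" "K \<subseteq> \<Omega>" using C by auto
    then have "K \<inter> \<Omega> = K" "K \<in> sets lebesgue"
      using borel_compact[OF K(1)] by auto
    then show "K \<inter> space (lebesgue_on \<Omega>) \<in> sets (lebesgue_on \<Omega>)"
      using \<open>open \<Omega>\<close> K(2) by (simp add: sets_restrict_space_iff)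
    have "G \<in> borel_measurable (lebesgue_on K)"
      using G K by (auto simp: has_weak_gradient_def)
    then show "G \<in> borel_measurable (restrict_space (lebesgue_on \<Omega>) K)"
      using \<open>open \<Omega>\<close> \<open>K \<in> sets lebesgue\<close> K(2)
      by (subst restrict_restrict_space) (auto simp: Int_absorb1)
  qed (use C in auto)
qed

section \<open>The Poincare inequality for test functions\<close>

text \<open>
  A form of Young's inequality in which the \<open>r\<close> term is small enough to be absorbed.
\<close>

lemma young_split:
  fixes a r p :: real
  assumes "0 \<le> a" "0 < r" "1 < p"
  shows "a * r powr (p - 1) \<le> r powr p / (2 * p) + (2 * p) powr (p - 1) * a powr p"
proof (cases "a \<le> r / (2 * p)")
  case True
  then have "a * r powr (p - 1) \<le> r / (2 * p) * r powr (p - 1)" by (intro mult_right_mono) auto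
  also have "\<dots> = r powr p / (2 * p)" using assms by (simp add: powr_diff)
  finally show ?thesis by (smt (verit) powr_ge_zero mult_nonneg_nonneg)
next
  case False
  then have "0 < a" using assms by (smt (verit) divide_nonneg_nonneg)
  from False have "r \<le> 2 * p * a" using assms by (simp add: field_simps)
  then have "a * r powr (p - 1) \<le> a * (2 * p * a) powr (p - 1)"
    using assms by (intro mult_left_mono powr_mono2) auto
  also have "\<dots> = (2 * p) powr (p - 1) * a powr p"
    using assms \<open>0 < a\<close> by (simp add: powr_mult powr_diff field_simps)
  finally show ?thesis using assms by (smt (verit) divide_nonneg_nonneg powr_ge_zero)
qed


text \<open>
  With \<open>A = \<phi>^2 + \<delta>^2\<close> set \<open>\<eta> = \<phi> A^((p - 2) / 2)\<close> and \<open>\<psi> = (x \<bullet> b) \<eta>\<close>, the regularised test function.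
  The function \<open>N = (A^(p/2) - \<delta>^p) / p\<close> satisfies \<open>\<partial>N = \<eta> \<partial>\<phi>\<close> and vanishes where \<open>\<phi>\<close> does, so
  \<open>\<Phi> = \<phi> \<psi> - (x \<bullet> b) N\<close> is a test function with \<open>\<partial>\<Phi> = \<phi> \<partial>\<psi> - N\<close>. As \<open>\<integral> \<partial>\<Phi> = 0\<close>,
  \<open>\<integral> N = \<integral> \<phi> \<partial>\<psi> = - \<integral> (V \<bullet> b) \<psi>\<close>. As \<open>p N + \<delta>^p = A^(p/2) \<ge> |\<phi>|^p\<close>, and \<open>|\<eta>|\<close> is at most
  \<open>A^((p - 1) / 2)\<close>, Young's inequality gives the claim up to a multiple of \<open>\<delta>^p\<close>.
\<close>

lemma poincare_test_function:
  fixes \<phi> :: "'a::euclidean_space \<Rightarrow> real"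
  assumes \<phi>: "\<phi> \<in> test_functions \<Omega>" and V: "has_weak_gradient \<Omega> \<phi> V" and "open \<Omega>"
    and R: "\<And>x. x \<in> \<Omega> \<Longrightarrow> norm x \<le> R" "0 < R" and "1 < p"
  shows "Lp_energy p \<Omega> \<phi> \<le> ennreal ((2 * p * R) powr p) * Lp_energy p \<Omega> V"
proof (cases "Lp_energy p \<Omega> V = top")
  case True
  then show ?thesis using assms by (simp add: ennreal_mult_top)
next
  case False
  obtain b :: 'a where b: "b \<in> Basis" using nonempty_Basis by blast
  have [measurable]: "V \<in> borel_measurable (lebesgue_on \<Omega>)"
    using has_weak_gradient_measurable[OF V \<open>open \<Omega>\<close>] .
  let ?M = "lebesgue_on \<Omega>"
  have "bounded \<Omega>" using R by (auto simp: bounded_iff)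
  then have "\<Omega> \<in> lmeasurable" using \<open>open \<Omega>\<close> by (intro lmeasurable_open)
  then interpret finite_measure ?M by (rule finite_measure_lebesgue_on)
  have intV: "integrable ?M (\<lambda>x. norm (V x) powr p)"
    using False by (intro integrableI_nonneg) (auto simp: Lp_energy_def less_top)
  let ?I = "\<integral>x. norm (V x) powr p \<partial>?M"
  have LpV: "Lp_energy p \<Omega> V = ennreal ?I"
    unfolding Lp_energy_def by (intro nn_integral_eq_integral intV) simp
  let ?m = "measure ?M \<Omega>"
  have bound: "Lp_energy p \<Omega> \<phi> \<le> ennreal ((2 * p * R) powr p * ?I + 2 * ?m * \<delta> powr p)" if "0 < \<delta>" for \<delta>
  proof -
    define A where "A x = \<phi> x * \<phi> x + \<delta> * \<delta>" for x
    define \<eta> where "\<eta> x = \<phi> x * A x powr ((p - 2) / 2)" for x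
    define N where "N x = (1 / p) * A x powr (p / 2) + - (\<delta> powr p / p)" for x
    define \<psi> where "\<psi> x = (x \<bullet> b) * \<eta> x" for x
    define \<Phi> where "\<Phi> x = \<phi> x * \<psi> x + (- 1) * ((x \<bullet> b) * N x)" for x
    have A: "0 < A x" "\<bar>\<phi> x\<bar> \<le> sqrt (A x)" for x
      using that by (auto simp: A_def add_nonneg_pos intro!: real_le_rsqrt simp: power2_eq_square)
    have Ck\<phi>: "Ck k \<phi>" for k using \<phi> by (simp add: test_functions_def)
    have CkA: "Ck k A" for k unfolding A_def by (intro Ck_add Ck_mult Ck_const Ck\<phi>)
    have Ck\<psi>: "Ck k \<psi>" for k
      unfolding \<psi>_def \<eta>_def by (intro Ck_mult Ck_inner_left Ck_powr Ck\<phi> CkA A)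
    have CkN: "Ck k N" for k
      unfolding N_def by (intro Ck_add Ck_mult Ck_const Ck_powr CkA A)
    have Ck\<Phi>: "Ck k \<Phi>" for k
      unfolding \<Phi>_def by (intro Ck_add Ck_mult Ck_const Ck_inner_left Ck\<phi> Ck\<psi> CkN)
    have N0: "N x = 0" if "\<phi> x = 0" for x
      using that \<open>0 < \<delta>\<close> by (simp add: N_def A_def powr_mult powr_add[symmetric])
    have \<psi>: "\<psi> \<in> test_functions \<Omega>"
      by (rule test_functions_subsupport[OF \<phi> Ck\<psi>]) (simp add: \<psi>_def \<eta>_def)
    have N: "N \<in> test_functions \<Omega>"
      by (rule test_functions_subsupport[OF \<phi> CkN N0])
    have \<Phi>: "\<Phi> \<in> test_functions \<Omega>"
      by (rule test_functions_subsupport[OF \<phi> Ck\<Phi>]) (simp add: \<Phi>_def N0)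
    have pdPhi: "frechet_derivative \<Phi> (at x) b = \<phi> x * frechet_derivative \<psi> (at x) b - N x" for x
    proof -
      note d\<phi> = test_function_has_derivative[OF \<phi>, of x]
      let ?\<phi>' = "frechet_derivative \<phi> (at x)"
      have "(A has_derivative (\<lambda>h. \<phi> x * ?\<phi>' h + ?\<phi>' h * \<phi> x)) (at x)"
        unfolding A_def by (auto intro!: derivative_eq_intros d\<phi>)
      from has_derivative_powr_const[OF this A(1), of "p / 2"]
      have "(N has_derivative (\<lambda>h. (1 / p) * (p / 2 * A x powr (p / 2 - 1) * (\<phi> x * ?\<phi>' h + ?\<phi>' h * \<phi> x)) + 0)) (at x)"
        unfolding N_def by (intro has_derivative_add has_derivative_mult_right has_derivative_const)
      moreover have "(1 / p) * (p / 2 * A x powr (p / 2 - 1) * (\<phi> x * ?\<phi>' h + ?\<phi>' h * \<phi> x)) + 0 = \<eta> x * ?\<phi>' h" for h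
        using \<open>1 < p\<close> by (simp add: \<eta>_def diff_divide_distrib)
      ultimately have dN: "(N has_derivative (\<lambda>h. \<eta> x * ?\<phi>' h)) (at x)" by simp
      have "(\<Phi> has_derivative (\<lambda>h. \<phi> x * frechet_derivative \<psi> (at x) h + ?\<phi>' h * \<psi> x
          + (- 1) * ((x \<bullet> b) * (\<eta> x * ?\<phi>' h) + (h \<bullet> b) * N x))) (at x)"
        unfolding \<Phi>_def
        by (intro has_derivative_add has_derivative_mult has_derivative_mult_right d\<phi> dN
            test_function_has_derivative[OF \<psi>] has_derivative_inner_left has_derivative_ident)
      from frechet_derivative_apply[OF this, of b] show ?thesis
        using b by (simp add: \<psi>_def algebra_simps)
    qed
    have intN: "integrable ?M N"
    proof -
      have "compact (closure {x. N x \<noteq> 0})" using N by (simp add: test_functions_def)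
      with continuous_on_test_function[OF N] have "integrable lborel N"
        using test_function_eq_0 by (rule integrable_compactly_supported)
      then show ?thesis
        using integrable_lebesgue_on_eq_lborel[OF test_function_borel_measurable[OF N] \<open>open \<Omega>\<close>
            test_function_outside(1)[OF N]] by simp
    qed
    have int\<phi>\<psi>: "integrable ?M (\<lambda>x. \<phi> x * frechet_derivative \<psi> (at x) b)"
      using weak_gradient_pairing_integrable(1)[OF V \<open>open \<Omega>\<close> \<psi> b] .
    have intV\<psi>: "integrable ?M (\<lambda>x. (V x \<bullet> b) * \<psi> x)"
      using weak_gradient_pairing_integrable(2)[OF V \<open>open \<Omega>\<close> \<psi> b] .
    have pos: "0 < A x powr (1 / 2)" for x using A(1)[of x] by simp
    have Ap: "A x powr (p / 2) = p * N x + \<delta> powr p" for x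
      using \<open>1 < p\<close> by (simp add: N_def field_simps)
    have "(\<integral>x. N x \<partial>?M) = (\<integral>x. \<phi> x * frechet_derivative \<psi> (at x) b \<partial>?M)"
      using integral_partial_lebesgue_on_eq_0[OF \<Phi> b \<open>open \<Omega>\<close>] int\<phi>\<psi> intN
      unfolding pdPhi by simp
    also have "\<dots> = (\<integral>x. - ((V x \<bullet> b) * \<psi> x) \<partial>?M)"
      using V \<psi> b by (simp add: has_weak_gradient_def)
    also have "\<dots> \<le> (\<integral>x. N x / 2 + (\<delta> powr p / (2 * p) + (2 * p) powr (p - 1) * R powr p * norm (V x) powr p) \<partial>?M)"
    proof (rule integral_mono)
      fix x assume "x \<in> space ?M"
      then have "norm x \<le> R" using R by simp
      let ?r = "A x powr (1 / 2)"
      have "\<bar>\<eta> x\<bar> \<le> ?r * A x powr ((p - 2) / 2)"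
        using A[of x] by (simp add: \<eta>_def abs_mult powr_half_sqrt mult_right_mono)
      also have "\<dots> = ?r powr (p - 1)"
        using A(1)[of x] by (simp add: powr_powr powr_add[symmetric] diff_divide_distrib)
      finally have \<eta>: "\<bar>\<eta> x\<bar> \<le> ?r powr (p - 1)" .
      have xb: "\<bar>x \<bullet> b\<bar> \<le> R" using Basis_le_norm[OF b, of x] \<open>norm x \<le> R\<close> by simp
      have "- ((V x \<bullet> b) * \<psi> x) \<le> \<bar>V x \<bullet> b\<bar> * (\<bar>x \<bullet> b\<bar> * \<bar>\<eta> x\<bar>)"
        using abs_ge_minus_self[of "(V x \<bullet> b) * \<psi> x"] by (simp add: \<psi>_def abs_mult)
      also have "\<dots> \<le> norm (V x) * (R * ?r powr (p - 1))"
        using R(2) by (intro mult_mono \<eta> xb Basis_le_norm b) auto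
      also have "\<dots> = (R * norm (V x)) * ?r powr (p - 1)" by simp
      also have "\<dots> \<le> ?r powr p / (2 * p) + (2 * p) powr (p - 1) * (R * norm (V x)) powr p"
        using R(2) \<open>1 < p\<close> pos by (intro young_split) auto
      also have "?r powr p / (2 * p) = N x / 2 + \<delta> powr p / (2 * p)"
        using \<open>1 < p\<close> Ap[of x] by (simp add: powr_powr add_divide_distrib)
      finally show "- ((V x \<bullet> b) * \<psi> x)
          \<le> N x / 2 + (\<delta> powr p / (2 * p) + (2 * p) powr (p - 1) * R powr p * norm (V x) powr p)"
        using R(2) by (simp add: powr_mult)
    qed (use intN intV intV\<psi> in auto)
    also have "\<dots> = (\<integral>x. N x \<partial>?M) / 2 + (\<delta> powr p / (2 * p) * ?m + (2 * p) powr (p - 1) * R powr p * ?I)"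
      using intN intV by (simp add: mult.commute)
    finally have "p * (\<integral>x. N x \<partial>?M) \<le> \<delta> powr p * ?m + 2 * p * ((2 * p) powr (p - 1) * R powr p * ?I)"
      using \<open>1 < p\<close> by (simp add: field_simps)
    also have "2 * p * ((2 * p) powr (p - 1) * R powr p * ?I) = (2 * p * R) powr p * ?I"
      using \<open>1 < p\<close> R(2) by (simp add: powr_mult powr_diff)
    finally have main: "p * (\<integral>x. N x \<partial>?M) \<le> \<delta> powr p * ?m + (2 * p * R) powr p * ?I" .
    have "Lp_energy p \<Omega> \<phi> \<le> (\<integral>\<^sup>+x. ennreal (p * N x + \<delta> powr p) \<partial>?M)"
      unfolding Lp_energy_def
    proof (intro nn_integral_mono ennreal_leI)
      fix x
      have "norm (\<phi> x) powr p \<le> (A x powr (1 / 2)) powr p"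
        using A[of x] \<open>1 < p\<close> by (intro powr_mono2) (auto simp: powr_half_sqrt)
      then show "norm (\<phi> x) powr p \<le> p * N x + \<delta> powr p"
        by (simp add: powr_powr Ap)
    qed
    also have "\<dots> = ennreal (\<integral>x. p * N x + \<delta> powr p \<partial>?M)"
    proof (rule nn_integral_eq_integral)
      show "AE x in ?M. 0 \<le> p * N x + \<delta> powr p" by (metis AE_I2 Ap powr_ge_zero)
    qed (use intN in simp)
    also have "(\<integral>x. p * N x + \<delta> powr p \<partial>?M) = p * (\<integral>x. N x \<partial>?M) + \<delta> powr p * ?m"
      using intN by (simp add: mult.commute)
    also have "ennreal \<dots> \<le> ennreal ((2 * p * R) powr p * ?I + 2 * ?m * \<delta> powr p)"
      using main by (intro ennreal_leI) (simp add: mult.commute)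
    finally show ?thesis .
  qed
  show ?thesis
  proof (rule ennreal_le_epsilon)
    fix e :: real assume "0 < e"
    \<comment> \<open>This makes the error \<open>2 |\<Omega>| \<delta>^p\<close> at most \<open>e\<close>; the summand 1 keeps the denominator positive for a null set.\<close>
    define \<delta> where "\<delta> = (e / (2 * ?m + 1)) powr (1 / p)"
    have m: "0 < 2 * ?m + 1" by (simp add: add_nonneg_pos)
    then have "0 < \<delta>" using \<open>0 < e\<close> by (simp add: \<delta>_def)
    have "2 * ?m * \<delta> powr p \<le> (2 * ?m + 1) * \<delta> powr p" by (intro mult_right_mono) auto
    also have "\<dots> = e" using \<open>1 < p\<close> \<open>0 < e\<close> m by (simp add: \<delta>_def powr_powr)
    finally have "2 * ?m * \<delta> powr p \<le> e" .
    then have "Lp_energy p \<Omega> \<phi> \<le> ennreal ((2 * p * R) powr p * ?I + e)"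
      using bound[OF \<open>0 < \<delta>\<close>] by (elim order_trans) (rule ennreal_leI; simp)
    also have "\<dots> = ennreal ((2 * p * R) powr p) * Lp_energy p \<Omega> V + ennreal e"
      using \<open>0 < e\<close> by (simp add: LpV ennreal_mult ennreal_plus)
    finally show "Lp_energy p \<Omega> \<phi> \<le> ennreal ((2 * p * R) powr p) * Lp_energy p \<Omega> V + ennreal e" .
  qed
qed


section \<open>Passing to the closure of the test functions\<close>

lemma powr_le_sum_powr:
  fixes a b c p :: real
  assumes "0 \<le> a" "0 \<le> b" "0 \<le> c" "c \<le> a + b" "0 \<le> p"
  shows "c powr p \<le> 2 powr p * (a powr p + b powr p)"
proof -
  have "c powr p \<le> (2 * max a b) powr p" using assms by (intro powr_mono2) auto
  also have "\<dots> = 2 powr p * max a b powr p" using assms by (simp add: powr_mult)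
  also have "\<dots> \<le> 2 powr p * (a powr p + b powr p)" by (intro mult_left_mono) (auto simp: max_def)
  finally show ?thesis .
qed

lemma Lp_energy_triangle:
  fixes u v w :: "'a::euclidean_space \<Rightarrow> 'b::euclidean_space"
  assumes [measurable]: "u \<in> borel_measurable (lebesgue_on \<Omega>)" "v \<in> borel_measurable (lebesgue_on \<Omega>)"
    and w: "\<And>x. norm (w x) \<le> norm (u x) + norm (v x)" and "0 \<le> p"
  shows "Lp_energy p \<Omega> w \<le> ennreal (2 powr p) * (Lp_energy p \<Omega> u + Lp_energy p \<Omega> v)"
proof -
  have "Lp_energy p \<Omega> w \<le> (\<integral>\<^sup>+x. ennreal (2 powr p) *
      (ennreal (norm (u x) powr p) + ennreal (norm (v x) powr p)) \<partial>lebesgue_on \<Omega>)"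
    unfolding Lp_energy_def using w \<open>0 \<le> p\<close>
    by (intro nn_integral_mono)
       (auto simp: ennreal_plus[symmetric] ennreal_mult[symmetric] intro!: ennreal_leI powr_le_sum_powr
         simp del: ennreal_plus)
  also have "\<dots> = ennreal (2 powr p) * (Lp_energy p \<Omega> u + Lp_energy p \<Omega> v)"
    unfolding Lp_energy_def by (subst nn_integral_cmult, measurable) (subst nn_integral_add; simp)
  finally show ?thesis .
qed

lemma gagliardo_energy_triangle:
  fixes u v w :: "'a::euclidean_space \<Rightarrow> real"
  assumes [measurable]: "u \<in> borel_measurable (lebesgue_on \<Omega>)" "v \<in> borel_measurable (lebesgue_on \<Omega>)"
    and w: "\<And>x y. \<bar>w x - w y\<bar> \<le> \<bar>u x - u y\<bar> + \<bar>v x - v y\<bar>" and "0 \<le> p" and \<Omega>: "\<Omega> \<in> lmeasurable"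
  shows "gagliardo_energy s p \<Omega> w \<le> ennreal (2 powr p) * (gagliardo_energy s p \<Omega> u + gagliardo_energy s p \<Omega> v)"
proof -
  interpret finite_measure "lebesgue_on \<Omega>" using \<Omega> by (rule finite_measure_lebesgue_on)
  have [measurable]: "(\<lambda>x. x) \<in> borel_measurable (lebesgue_on \<Omega>)"
    using id_borel_measurable_lebesgue_on[of \<Omega>] by (simp add: id_def)
  let ?q = "real DIM('a) + s * p"
  let ?K = "\<lambda>u x y. ennreal (\<bar>u x - u y\<bar> powr p / norm (x - y) powr ?q)"
  have "?K w x y \<le> ennreal (2 powr p) * (?K u x y + ?K v x y)" for x y
  proof -
    have "\<bar>w x - w y\<bar> powr p / norm (x - y) powr ?q
        \<le> (2 powr p * (\<bar>u x - u y\<bar> powr p + \<bar>v x - v y\<bar> powr p)) / norm (x - y) powr ?q"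
      using w \<open>0 \<le> p\<close> by (intro divide_right_mono powr_le_sum_powr) auto
    also have "\<dots> = 2 powr p * (\<bar>u x - u y\<bar> powr p / norm (x - y) powr ?q + \<bar>v x - v y\<bar> powr p / norm (x - y) powr ?q)"
      by (simp add: add_divide_distrib distrib_left)
    finally show ?thesis
      by (simp add: ennreal_plus[symmetric] ennreal_mult[symmetric] ennreal_leI del: ennreal_plus)
  qed
  then have "gagliardo_energy s p \<Omega> w \<le> (\<integral>\<^sup>+x. \<integral>\<^sup>+y. ennreal (2 powr p) * (?K u x y + ?K v x y)
      \<partial>lebesgue_on \<Omega> \<partial>lebesgue_on \<Omega>)"
    unfolding gagliardo_energy_def by (intro nn_integral_mono)
  also have "\<dots> = (\<integral>\<^sup>+x. ennreal (2 powr p) *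
      ((\<integral>\<^sup>+y. ?K u x y \<partial>lebesgue_on \<Omega>) + (\<integral>\<^sup>+y. ?K v x y \<partial>lebesgue_on \<Omega>)) \<partial>lebesgue_on \<Omega>)"
    by (intro nn_integral_cong, subst nn_integral_cmult, measurable) (subst nn_integral_add; simp)
  also have "\<dots> = ennreal (2 powr p) * (gagliardo_energy s p \<Omega> u + gagliardo_energy s p \<Omega> v)"
    unfolding gagliardo_energy_def by (subst nn_integral_cmult, measurable) (subst nn_integral_add; simp)
  finally show ?thesis .
qed

text \<open>
  The common shape of both closure arguments: \<open>a'\<close> and \<open>g'\<close> are the two sides of the inequality for an
  approximating test function.
\<close>

lemma inequality_by_approximation:
  fixes a g :: ennreal and K c :: real
  assumes "0 < K" "0 \<le> c"
    and approx: "\<And>e. 0 < e \<Longrightarrow> \<exists>a' g'. a \<le> ennreal K * (a' + ennreal e) \<and> a' \<le> ennreal c * g' \<and>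
      g' \<le> ennreal K * (g + ennreal e)"
  shows "a \<le> ennreal (K * c * K) * g"
proof (rule ennreal_le_epsilon)
  fix e :: real assume "0 < e"
  define d where "d = e / (K * c * K + K)"
  have pos: "0 < K * c * K + K" using assms by (intro add_nonneg_pos) auto
  then have "0 < d" using \<open>0 < e\<close> by (simp add: d_def)
  then obtain a' g' where le: "a \<le> ennreal K * (a' + ennreal d)" "a' \<le> ennreal c * g'" "g' \<le> ennreal K * (g + ennreal d)"
    using approx by blast
  have "a \<le> ennreal K * (ennreal c * (ennreal K * (g + ennreal d)) + ennreal d)"
    by (intro order_trans[OF le(1)] mult_left_mono add_right_mono order_trans[OF le(2)] le(3)) simp_all
  also have "\<dots> = ennreal (K * c * K) * g + ennreal (K * c * K * d + K * d)"
    using assms \<open>0 < d\<close> by (simp add: distrib_left ennreal_mult mult_ac add_ac)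
  also have "K * c * K * d + K * d = (K * c * K + K) * d" by (simp add: distrib_right)
  also have "\<dots> = e" using pos by (simp add: d_def)
  finally show "a \<le> ennreal (K * c * K) * g + ennreal e" .
qed

lemma sobolev0_approx:
  assumes "u \<in> sobolev0 s p \<Omega>" "0 < p" "0 < e"
  obtains \<phi> where "\<phi> \<in> test_functions \<Omega>" "sobolev_norm_pow s p \<Omega> (\<lambda>x. u x - \<phi> x) \<le> ennreal e"
proof -
  have "0 < e powr (1 / p)" "(e powr (1 / p)) powr p = e" using assms by (simp_all add: powr_powr)
  moreover have "\<forall>\<epsilon>>0. \<exists>\<phi>\<in>test_functions \<Omega>.
      sobolev_norm_pow s p \<Omega> (\<lambda>x. u x - \<phi> x) < ennreal (\<epsilon> powr p)"
    using assms(1) by (simp add: sobolev0_def)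
  ultimately show ?thesis using that by (metis order_less_imp_le)
qed

lemma emeasure_shell:
  obtains M where "0 < M" "emeasure lborel {v::'a::euclidean_space. 1 < norm v \<and> norm v < 2} = ennreal M"
proof -
  let ?S = "{v::'a. 1 < norm v \<and> norm v < 2}"
  have "open ?S" by (intro open_Collect_conj open_Collect_less continuous_intros)
  obtain b :: 'a where "b \<in> Basis" using nonempty_Basis by blast
  then have "(3 / 2) *\<^sub>R b \<in> ?S" by simp
  then have "?S \<noteq> {}" by blast
  with \<open>open ?S\<close> have "\<not> negligible ?S" by (rule open_not_negligible)
  then have "emeasure lborel ?S \<noteq> 0"
    using \<open>open ?S\<close> by (auto simp: negligible_iff_null_sets null_sets_def)
  moreover have "emeasure lborel ?S < \<infinity>"
    by (rule emeasure_bounded_finite) (auto simp: bounded_iff intro!: exI[of _ 2])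
  ultimately show ?thesis using that by (cases "emeasure lborel ?S" rule: ennreal_cases) (auto simp: less_le)
qed

text \<open>
  The inequality for \<open>\<phi>\<close> is applied with the difference of the chosen weak gradients of \<open>u\<close> and
  \<open>u - \<phi>\<close>, which is a weak gradient of \<open>\<phi> = u - (u - \<phi>)\<close>; the second of the two is small in
  \<open>L^p\<close> by the choice of \<open>\<phi>\<close>.
\<close>

lemma poincare_sobolev0:
  fixes \<Omega> :: "'a::euclidean_space set"
  assumes "open \<Omega>" "bounded \<Omega>" "1 < p"
  shows "\<exists>C>0. \<forall>u\<in>sobolev0 1 p \<Omega>. Lp_energy p \<Omega> u \<le> ennreal C * Lp_energy p \<Omega> (weak_gradient \<Omega> u)"
proof -
  obtain R where R: "0 < R" "\<And>x. x \<in> \<Omega> \<Longrightarrow> norm x \<le> R"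
    using \<open>bounded \<Omega>\<close> by (auto simp: bounded_pos)
  let ?c = "(2 * p * R) powr p"
  have "Lp_energy p \<Omega> u \<le> ennreal (2 powr p * ?c * 2 powr p) * Lp_energy p \<Omega> (weak_gradient \<Omega> u)"
    if u: "u \<in> sobolev0 1 p \<Omega>" for u
  proof (rule inequality_by_approximation)
    fix e :: real assume "0 < e"
    then obtain \<phi> where \<phi>: "\<phi> \<in> test_functions \<Omega>" and close: "sobolev_norm_pow 1 p \<Omega> (\<lambda>x. u x - \<phi> x) \<le> ennreal e"
      using sobolev0_approx[OF u] \<open>1 < p\<close> by auto
    let ?w = "\<lambda>x. u x - \<phi> x"
    let ?V = "\<lambda>x. weak_gradient \<Omega> u x - weak_gradient \<Omega> ?w x"
    have [measurable]: "u \<in> borel_measurable (lebesgue_on \<Omega>)" "\<phi> \<in> borel_measurable (lebesgue_on \<Omega>)"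
      using u continuous_imp_borel_measurable_lebesgue_on[OF continuous_on_test_function[OF \<phi>]]
      by (auto simp: sobolev0_def sobolev_def)
    have G: "has_weak_gradient \<Omega> u (weak_gradient \<Omega> u)"
    proof -
      have "\<exists>G. has_weak_gradient \<Omega> u G" using u by (auto simp: sobolev0_def sobolev_def)
      then show ?thesis unfolding weak_gradient_def by (rule someI_ex)
    qed
    have Gw: "has_weak_gradient \<Omega> ?w (weak_gradient \<Omega> ?w)"
    proof -
      have "\<exists>H. has_weak_gradient \<Omega> ?w H"
        using has_weak_gradient_diff[OF G has_weak_gradient_test_function[OF \<phi> \<open>open \<Omega>\<close>] \<open>open \<Omega>\<close>] by blast
      then show ?thesis unfolding weak_gradient_def by (rule someI_ex)
    qed
    have V: "has_weak_gradient \<Omega> \<phi> ?V"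
      using has_weak_gradient_diff[OF G Gw \<open>open \<Omega>\<close>] by simp
    have Lw: "Lp_energy p \<Omega> ?w \<le> ennreal e" "Lp_energy p \<Omega> (weak_gradient \<Omega> ?w) \<le> ennreal e"
      using close by (auto simp: sobolev_norm_pow_def intro: order_trans[rotated])
    have "Lp_energy p \<Omega> u \<le> ennreal (2 powr p) * (Lp_energy p \<Omega> \<phi> + Lp_energy p \<Omega> ?w)"
      using \<open>1 < p\<close> by (intro Lp_energy_triangle) auto
    also have "\<dots> \<le> ennreal (2 powr p) * (Lp_energy p \<Omega> \<phi> + ennreal e)"
      by (intro mult_left_mono add_left_mono Lw) simp
    finally have 1: "Lp_energy p \<Omega> u \<le> ennreal (2 powr p) * (Lp_energy p \<Omega> \<phi> + ennreal e)" .
    have 2: "Lp_energy p \<Omega> \<phi> \<le> ennreal ?c * Lp_energy p \<Omega> ?V"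
      using R \<open>1 < p\<close> by (intro poincare_test_function[OF \<phi> V \<open>open \<Omega>\<close>])
    have "Lp_energy p \<Omega> ?V \<le> ennreal (2 powr p) * (Lp_energy p \<Omega> (weak_gradient \<Omega> u) + Lp_energy p \<Omega> (weak_gradient \<Omega> ?w))"
      using \<open>1 < p\<close> has_weak_gradient_measurable[OF G \<open>open \<Omega>\<close>] has_weak_gradient_measurable[OF Gw \<open>open \<Omega>\<close>]
      by (intro Lp_energy_triangle norm_triangle_ineq4) auto
    also have "\<dots> \<le> ennreal (2 powr p) * (Lp_energy p \<Omega> (weak_gradient \<Omega> u) + ennreal e)"
      by (intro mult_left_mono add_left_mono Lw) simp
    finally show "\<exists>a' g'. Lp_energy p \<Omega> u \<le> ennreal (2 powr p) * (a' + ennreal e) \<and> a' \<le> ennreal ?c * g' \<and>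
      g' \<le> ennreal (2 powr p) * (Lp_energy p \<Omega> (weak_gradient \<Omega> u) + ennreal e)"
      using 1 2 by blast
  qed simp_all
  moreover have "0 < 2 powr p * ?c * 2 powr p" using R \<open>1 < p\<close> by simp
  ultimately show ?thesis by blast
qed

text \<open>
  The constant is uniform in \<open>s\<close> because \<open>\<delta>\<close> is fixed by the smallest exponent \<open>s0 - 1/p\<close>, and because
  the bases \<open>D\<close> and \<open>2\<close> are at least \<open>1\<close>, which allows \<open>s p\<close> to be replaced by \<open>p\<close> in the exponents.
\<close>

lemma fractional_poincare_sobolev0:
  fixes \<Omega> :: "'a::euclidean_space set"
  assumes "open \<Omega>" "bounded \<Omega>" "1 < p" "1 / p < s0"
  shows "\<exists>C\<ge>0. \<forall>s. s0 \<le> s \<and> s < 1 \<longrightarrow> (\<forall>u\<in>sobolev0 s p \<Omega>.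
    Lp_energy p \<Omega> u \<le> ennreal (C * (1 - s)) * gagliardo_energy s p \<Omega> u)"
proof -
  obtain R where R: "0 < R" "\<And>x. x \<in> \<Omega> \<Longrightarrow> norm x \<le> R"
    using \<open>bounded \<Omega>\<close> by (auto simp: bounded_pos)
  define D where "D = 2 * R + 1"
  have D: "dist x y \<le> D" if "x \<in> \<Omega>" "y \<in> \<Omega>" for x y
    using R(2)[OF that(1)] R(2)[OF that(2)] norm_triangle_ineq4[of x y] by (simp add: D_def dist_norm)
  have D1: "1 \<le> D" using R by (simp add: D_def)
  have \<Omega>: "\<Omega> \<in> lmeasurable" using assms by (intro lmeasurable_open)
  obtain M where M: "0 < M" "emeasure lborel {v::'a. 1 < norm v \<and> norm v < 2} = ennreal M"
    using emeasure_shell by blast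
  \<comment> \<open>Chosen so that \<open>4 \<delta>^(s - 1/p) \<le> 1\<close> holds with equality at \<open>s = s0\<close>, hence for all \<open>s \<ge> s0\<close>.\<close>
  define \<delta> where "\<delta> = (1 / 4) powr (1 / (s0 - 1 / p))"
  have \<delta>: "0 < \<delta>" "\<delta> < 1" "4 * \<delta> powr (s0 - 1 / p) = 1"
    using \<open>1 / p < s0\<close> powr_less_mono'[of "1 / 4" 0 "1 / (s0 - 1 / p)"] by (simp_all add: \<delta>_def powr_powr)
  define C0 where "C0 = 4 powr p * \<delta> powr (- p) * p * D powr p * 2 powr (real DIM('a) + p) / M"
  have "0 \<le> C0" using \<open>1 < p\<close> M by (simp add: C0_def)
  have "Lp_energy p \<Omega> u \<le> ennreal (2 powr p * (C0 * (1 - s)) * 2 powr p) * gagliardo_energy s p \<Omega> u"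
    if s: "s0 \<le> s" "s < 1" and u: "u \<in> sobolev0 s p \<Omega>" for s u
  proof (rule inequality_by_approximation)
    fix e :: real assume "0 < e"
    then obtain \<phi> where \<phi>: "\<phi> \<in> test_functions \<Omega>" and close: "sobolev_norm_pow s p \<Omega> (\<lambda>x. u x - \<phi> x) \<le> ennreal e"
      using sobolev0_approx[OF u] \<open>1 < p\<close> by auto
    let ?w = "\<lambda>x. u x - \<phi> x"
    have [measurable]: "u \<in> borel_measurable (lebesgue_on \<Omega>)" "\<phi> \<in> borel_measurable (lebesgue_on \<Omega>)"
      using u continuous_imp_borel_measurable_lebesgue_on[OF continuous_on_test_function[OF \<phi>]]
      by (auto simp: sobolev0_def sobolev_def)
    have w: "Lp_energy p \<Omega> ?w \<le> ennreal e" "gagliardo_energy s p \<Omega> ?w \<le> ennreal e"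
      using close s by (auto simp: sobolev_norm_pow_def intro: order_trans[rotated])
    have "Lp_energy p \<Omega> u \<le> ennreal (2 powr p) * (Lp_energy p \<Omega> \<phi> + Lp_energy p \<Omega> ?w)"
      using \<open>1 < p\<close> by (intro Lp_energy_triangle) auto
    also have "\<dots> \<le> ennreal (2 powr p) * (Lp_energy p \<Omega> \<phi> + ennreal e)"
      by (intro mult_left_mono add_left_mono w) simp
    finally have 1: "Lp_energy p \<Omega> u \<le> ennreal (2 powr p) * (Lp_energy p \<Omega> \<phi> + ennreal e)" .
    have 2: "Lp_energy p \<Omega> \<phi> \<le> ennreal (C0 * (1 - s)) * gagliardo_energy s p \<Omega> \<phi>"
    proof -
      obtain L where "L-lipschitz_on UNIV \<phi>" using test_function_lipschitz[OF \<phi>] .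
      moreover have "\<delta> powr (s - 1 / p) \<le> \<delta> powr (s0 - 1 / p)"
        using \<delta> s by (intro powr_mono') auto
      ultimately have "ennreal M * Lp_energy p \<Omega> \<phi>
        \<le> ennreal (4 powr p * \<delta> powr (- p) * p * (1 - s) * D powr (s * p) * 2 powr (real DIM('a) + s * p)) *
          gagliardo_energy s p \<Omega> \<phi>"
        unfolding M(2)[symmetric] using \<delta> assms s D1 test_function_outside(1)[OF \<phi>]
        by (intro fractional_poincare_lipschitz[OF \<open>open \<Omega>\<close> D]) auto
      also have "\<dots> \<le> ennreal (M * (C0 * (1 - s))) * gagliardo_energy s p \<Omega> \<phi>"
      proof (intro mult_right_mono ennreal_leI)
        have "s * p \<le> p" using s \<open>1 < p\<close> by simp
        have "4 powr p * \<delta> powr (- p) * p * (1 - s) * D powr (s * p) * 2 powr (real DIM('a) + s * p)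
            \<le> 4 powr p * \<delta> powr (- p) * p * (1 - s) * D powr p * 2 powr (real DIM('a) + p)"
          using \<open>s * p \<le> p\<close> s \<open>1 < p\<close> D1
          by (intro mult_mono[OF mult_left_mono] powr_mono) auto
        also have "\<dots> = M * (C0 * (1 - s))" using M by (simp add: C0_def)
        finally show "4 powr p * \<delta> powr (- p) * p * (1 - s) * D powr (s * p) * 2 powr (real DIM('a) + s * p)
            \<le> M * (C0 * (1 - s))" .
      qed simp
      also have "\<dots> = ennreal M * (ennreal (C0 * (1 - s)) * gagliardo_energy s p \<Omega> \<phi>)"
        using M \<open>0 \<le> C0\<close> s by (simp add: ennreal_mult mult.assoc)
      finally show ?thesis
        using M by (subst (asm) ennreal_mult_le_mult_iff) auto
    qed
    have "gagliardo_energy s p \<Omega> \<phi> \<le> ennreal (2 powr p) * (gagliardo_energy s p \<Omega> u + gagliardo_energy s p \<Omega> ?w)"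
      using \<open>1 < p\<close> \<Omega> by (intro gagliardo_energy_triangle) auto
    also have "\<dots> \<le> ennreal (2 powr p) * (gagliardo_energy s p \<Omega> u + ennreal e)"
      by (intro mult_left_mono add_left_mono w) simp
    finally show "\<exists>a' g'. Lp_energy p \<Omega> u \<le> ennreal (2 powr p) * (a' + ennreal e) \<and> a' \<le> ennreal (C0 * (1 - s)) * g' \<and>
      g' \<le> ennreal (2 powr p) * (gagliardo_energy s p \<Omega> u + ennreal e)"
      using 1 2 by blast
  qed (use \<open>0 \<le> C0\<close> s in auto)
  then have "\<forall>s. s0 \<le> s \<and> s < 1 \<longrightarrow> (\<forall>u\<in>sobolev0 s p \<Omega>.
      Lp_energy p \<Omega> u \<le> ennreal (2 powr p * C0 * 2 powr p * (1 - s)) * gagliardo_energy s p \<Omega> u)"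
    by (simp add: mult_ac)
  moreover have "0 \<le> 2 powr p * C0 * 2 powr p" using \<open>0 \<le> C0\<close> by simp
  ultimately show ?thesis by blast
qed

theorem theorem6p2:
  fixes \<Omega> :: "'a::euclidean_space set" and p :: real
  assumes "open \<Omega>" and "bounded \<Omega>" and "lipschitz_boundary \<Omega>" and "1 < p"
  shows "(\<exists>s0 B :: real. 1 / p < s0 \<and> s0 < 1 \<and> B > 1 \<and>
            (\<forall>s. s0 \<le> s \<and> s < 1 \<longrightarrow> (\<forall>u \<in> sobolev0 s p \<Omega>.
               (\<integral>\<^sup>+ x. ennreal (\<bar>u x\<bar> powr p) \<partial>lebesgue_on \<Omega>) \<le>
               ennreal (B * s * (1 - s)) *
                 (\<integral>\<^sup>+ x. (\<integral>\<^sup>+ y. ennreal (\<bar>u x - u y\<bar> powr p /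
                     norm (x - y) powr (real DIM('a) + s * p))
                   \<partial>lebesgue_on \<Omega>) \<partial>lebesgue_on \<Omega>)))) \<and>
         (\<exists>C :: real. C > 0 \<and>
            (\<forall>u \<in> sobolev0 1 p \<Omega>.
               (\<integral>\<^sup>+ x. ennreal (\<bar>u x\<bar> powr p) \<partial>lebesgue_on \<Omega>) \<le>
               ennreal C * (\<integral>\<^sup>+ x. ennreal (norm (weak_gradient \<Omega> u x) powr p) \<partial>lebesgue_on \<Omega>)))"
proof -
  \<comment> \<open>Any number strictly between \<open>1/p\<close> and \<open>1\<close> would do.\<close>
  define s0 where "s0 = (1 + 1 / p) / 2"
  have "1 / p < 1" using \<open>1 < p\<close> by simp
  then have s0: "1 / p < s0" "s0 < 1" by (simp_all add: s0_def)
  have "0 < 1 / p" using \<open>1 < p\<close> by simp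
  then have "0 < s0" using s0 by linarith
  obtain C where "0 \<le> C" and C: "\<And>s u. s0 \<le> s \<Longrightarrow> s < 1 \<Longrightarrow> u \<in> sobolev0 s p \<Omega> \<Longrightarrow>
      Lp_energy p \<Omega> u \<le> ennreal (C * (1 - s)) * gagliardo_energy s p \<Omega> u"
    using fractional_poincare_sobolev0[OF \<open>open \<Omega>\<close> \<open>bounded \<Omega>\<close> \<open>1 < p\<close> s0(1)] by blast
  \<comment> \<open>Dividing by \<open>s0\<close> pays for the factor \<open>s\<close> in the statement, as \<open>s \<ge> s0\<close>.\<close>
  define B where "B = C / s0 + 2"
  have part1: "Lp_energy p \<Omega> u \<le> ennreal (B * s * (1 - s)) * gagliardo_energy s p \<Omega> u"
    if s: "s0 \<le> s" "s < 1" and u: "u \<in> sobolev0 s p \<Omega>" for s u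
  proof -
    have "C = C / s0 * s0" using \<open>0 < s0\<close> by simp
    also have "\<dots> \<le> B * s"
      using s \<open>0 < s0\<close> \<open>0 \<le> C\<close> by (intro mult_mono) (auto simp: B_def)
    finally have "C * (1 - s) \<le> B * s * (1 - s)" using s by (intro mult_right_mono) auto
    then show ?thesis
      using C[OF s u] by (elim order_trans) (rule mult_right_mono[OF ennreal_leI]; simp)
  qed
  have "0 \<le> C / s0" using \<open>0 \<le> C\<close> \<open>0 < s0\<close> by simp
  then have "B > 1" by (simp add: B_def)
  show ?thesis
  proof (intro conjI)
    show "\<exists>s0 B. 1 / p < s0 \<and> s0 < 1 \<and> B > 1 \<and> (\<forall>s. s0 \<le> s \<and> s < 1 \<longrightarrow> (\<forall>u \<in> sobolev0 s p \<Omega>.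
        (\<integral>\<^sup>+ x. ennreal (\<bar>u x\<bar> powr p) \<partial>lebesgue_on \<Omega>) \<le> ennreal (B * s * (1 - s)) *
          (\<integral>\<^sup>+ x. (\<integral>\<^sup>+ y. ennreal (\<bar>u x - u y\<bar> powr p / norm (x - y) powr (real DIM('a) + s * p))
            \<partial>lebesgue_on \<Omega>) \<partial>lebesgue_on \<Omega>)))"
      using part1 unfolding Lp_energy_def gagliardo_energy_def real_norm_def
      by (intro exI[of _ s0] exI[of _ B] conjI s0 \<open>B > 1\<close>) blast
    show "\<exists>C>0. \<forall>u \<in> sobolev0 1 p \<Omega>. (\<integral>\<^sup>+ x. ennreal (\<bar>u x\<bar> powr p) \<partial>lebesgue_on \<Omega>) \<le>
        ennreal C * (\<integral>\<^sup>+ x. ennreal (norm (weak_gradient \<Omega> u x) powr p) \<partial>lebesgue_on \<Omega>)"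
      using poincare_sobolev0[OF \<open>open \<Omega>\<close> \<open>bounded \<Omega>\<close> \<open>1 < p\<close>]
      unfolding Lp_energy_def real_norm_def .
  qed
qed

end
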